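(* Let $m\in\mathbb Z_{\ge0}$ and $J\subset[1,m-1]$. (a) Let $n\ge4m-1$ and suppose that $K\subset[2m+1,n-2m]$ and $n+1-K$ are weakly orthogonal. Then the assignments $$\widehat T_1\mapsto T_{w_\circ^{[1,2m-1]\cup[n+2-2m,n]\cup K}},\qquad\widehat T_2\mapsto T_{w_\circ^{[m+1,n-m]\cup J\cup(n+1-J)}}$$ define a homomorphism $\mathrm{Br}^+(B_2)\to\mathrm{Br}^+(A_n)$. (b) Let $n\ge2m$ and $K\subset[2m+1,n]$. Then the assignments $$\widehat T_1\mapsto T_{w_\circ^{[1,2m-1]\cup K}},\qquad\widehat T_2\mapsto T_{w_\circ^{[m+1,n]\cup J}}$$ define a homomorphism $\mathrm{Br}^+(B_2)\to\mathrm{Br}^+(B_n)$. (c) Let $n\ge2m$. Let $K\subset[2m+1,n+1]$ and, if $n-m$ is even, assume in addition that $K$ and $\tau(K)$ are weakly orthogonal, where $\tau$ is the transposition $(n,n+1)$. Then the assignments $$\widehat T_1\mapsto T_{w_\circ^{[1,2m-1]\cup K}},\qquad\widehat T_2\mapsto T_{w_\circ^{[m+1,n+1]\cup J}}$$ define a homomorphism $\mathrm{Br}^+(B_2)\to\mathrm{Br}^+(D_{n+1})$.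
   Context: $[a,b]=\{i\in\mathbb Z:a\le i\le b\}$ (empty if $a>b$); $n+1-K=\{n+1-k:k\in K\}$. For a Coxeter matrix $M=(m_{ij})_{i,j\in I}$ (symmetric, $m_{ii}=1$, $m_{ij}\in\mathbb Z_{\ge2}\cup\{\infty\}$ for $i\ne j$), the Artin monoid $\mathrm{Br}^+(M)$ is generated by $T_i$, $i\in I$, subject to $T_iT_jT_i\cdots=T_jT_iT_j\cdots$ ($m_{ij}$ factors on each side) for $i\neq j$, $m_{ij}<\infty$; $W(M)$ is the Coxeter group with simple generators $s_i$, $i\in I$. $A_n$ ($n\ge1$): $I=[1,n]$, $m_{ij}=3$ if $|i-j|=1$, $m_{ij}=2$ if $|i-j|>1$. $B_n$ ($n\ge2$): the same except $m_{n-1,n}=4$. $D_{n+1}$ ($n\ge3$): $I=[1,n+1]$, $m_{i,i+1}=3$ for $1\le i\le n-1$, $m_{n-1,n+1}=3$, all other off-diagonal entries $2$ (up to symmetry). $\widehat T_1,\widehat T_2$ are the generators of $\mathrm{Br}^+(B_2)$, with relation $(\widehat T_1\widehat T_2)^2=(\widehat T_2\widehat T_1)^2$. For $w\in W(M)$, $T_w$ is the product of the $T_i$ along any reduced expression of $w$; for $K\subset I$ with $\langle s_k:k\in K\rangle$ finite, $w_\circ^K$ is the longest element of this subgroup (so $T_{w_\circ^\emptyset}=1$). Subsets $J,K\subset I$ are orthogonal if $m_{jk}=2$ for all $j\in J$, $k\in K$; they are weakly orthogonal if $J\setminus K$ is orthogonal to $K$ and $K\setminus J$ is orthogonal to $J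$.
   Formalization: In (c) it is assumed in addition that n+1 is not in K when n=2m; as printed the claim fails for n=2m, K={n+1} (e.g. m=2, n=4, J empty, K={5}), because node n+1 is then adjacent to 2m-1. *)

theory Defs
  imports "HOL-Algebra.Generated_Groups" "HOL-Combinatorics.Transposition"
    "HOL-Library.Extended_Nat"
begin

section \<open>Monoids given by generators and relations\<close>

inductive_set word_cong :: "'i set \<Rightarrow> ('i list \<times> 'i list) set \<Rightarrow> ('i list \<times> 'i list) set"
  for I :: "'i set" and R :: "('i list \<times> 'i list) set" where
  rel: "\<lbrakk>(u, v) \<in> R; u \<in> lists I; v \<in> lists I; a \<in> lists I; b \<in> lists I\<rbrakk>
          \<Longrightarrow> (a @ u @ b, a @ v @ b) \<in> word_cong I R"
| refl: "u \<in> lists I \<Longrightarrow> (u, u) \<in> word_cong I R"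
| sym: "(u, v) \<in> word_cong I R \<Longrightarrow> (v, u) \<in> word_cong I R"
| trans: "\<lbrakk>(u, v) \<in> word_cong I R; (v, w) \<in> word_cong I R\<rbrakk> \<Longrightarrow> (u, w) \<in> word_cong I R"

definition word_class :: "'i set \<Rightarrow> ('i list \<times> 'i list) set \<Rightarrow> 'i list \<Rightarrow> 'i list set" where
  "word_class I R u = word_cong I R `` {u}"

definition presented_monoid :: "'i set \<Rightarrow> ('i list \<times> 'i list) set \<Rightarrow> 'i list set monoid" where
  "presented_monoid I R =
     \<lparr>carrier = lists I // word_cong I R,
      monoid.mult = (\<lambda>A B. \<Union>a\<in>A. \<Union>b\<in>B. word_class I R (a @ b)),
      one = word_class I R []\<rparr>"

text \<open>Unlike \<^const>\<open>hom\<close>, homomorphisms of monoids are required to preserve the unit.\<close>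

definition monoid_hom :: "('a, 'c) monoid_scheme \<Rightarrow> ('b, 'd) monoid_scheme \<Rightarrow> ('a \<Rightarrow> 'b) set" where
  "monoid_hom G H = {h \<in> hom G H. h \<one>\<^bsub>G\<^esub> = \<one>\<^bsub>H\<^esub>}"

section \<open>Coxeter matrices, Artin monoids and Coxeter groups\<close>

record 'i coxeter_matrix =
  nodes :: "'i set"
  entry :: "'i \<Rightarrow> 'i \<Rightarrow> enat"

definition is_coxeter_matrix :: "'i coxeter_matrix \<Rightarrow> bool" where
  "is_coxeter_matrix M \<longleftrightarrow>
     (\<forall>i\<in>nodes M. entry M i i = 1) \<and>
     (\<forall>i\<in>nodes M. \<forall>j\<in>nodes M. entry M i j = entry M j i \<and> (i \<noteq> j \<longrightarrow> 2 \<le> entry M i j))"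

text \<open>The word \<open>i j i \<dots>\<close> with \<open>k\<close> letters.\<close>

fun alternating :: "'i \<Rightarrow> 'i \<Rightarrow> nat \<Rightarrow> 'i list" where
  "alternating i j 0 = []"
| "alternating i j (Suc k) = i # alternating j i k"

definition braid_relations :: "'i coxeter_matrix \<Rightarrow> ('i list \<times> 'i list) set" where
  "braid_relations M =
     {(alternating i j k, alternating j i k) | i j k.
        i \<in> nodes M \<and> j \<in> nodes M \<and> i \<noteq> j \<and> entry M i j = enat k}"

definition artin_monoid :: "'i coxeter_matrix \<Rightarrow> 'i list set monoid" where
  "artin_monoid M = presented_monoid (nodes M) (braid_relations M)"

text \<open>The relations \<open>(s\<^sub>i s\<^sub>j)\<^sup>m = 1\<close> for \<open>m = m\<^sub>i\<^sub>j < \<infinity>\<close>. The case \<open>i = j\<close> makes every generator an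
  involution, so the monoid presented by these relations is the Coxeter group.\<close>

definition coxeter_relations :: "'i coxeter_matrix \<Rightarrow> ('i list \<times> 'i list) set" where
  "coxeter_relations M =
     {(concat (replicate k [i, j]), []) | i j k.
        i \<in> nodes M \<and> j \<in> nodes M \<and> entry M i j = enat k}"

definition coxeter_group :: "'i coxeter_matrix \<Rightarrow> 'i list set monoid" where
  "coxeter_group M = presented_monoid (nodes M) (coxeter_relations M)"

definition artin_word :: "'i coxeter_matrix \<Rightarrow> 'i list \<Rightarrow> 'i list set" where
  "artin_word M = word_class (nodes M) (braid_relations M)"

definition coxeter_word :: "'i coxeter_matrix \<Rightarrow> 'i list \<Rightarrow> 'i list set" where
  "coxeter_word M = word_class (nodes M) (coxeter_relations M)"

abbreviation artin_gen :: "'i coxeter_matrix \<Rightarrow> 'i \<Rightarrow> 'i list set" where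
  "artin_gen M i \<equiv> artin_word M [i]"

abbreviation coxeter_gen :: "'i coxeter_matrix \<Rightarrow> 'i \<Rightarrow> 'i list set" where
  "coxeter_gen M i \<equiv> coxeter_word M [i]"

definition coxeter_length :: "'i coxeter_matrix \<Rightarrow> 'i list set \<Rightarrow> nat" where
  "coxeter_length M w = (LEAST k. \<exists>u\<in>lists (nodes M). coxeter_word M u = w \<and> length u = k)"

definition reduced_expression :: "'i coxeter_matrix \<Rightarrow> 'i list set \<Rightarrow> 'i list \<Rightarrow> bool" where
  "reduced_expression M w u \<longleftrightarrow>
     u \<in> lists (nodes M) \<and> coxeter_word M u = w \<and> length u = coxeter_length M w"

text \<open>\<open>T\<^sub>w\<close>; by Matsumoto's theorem it does not depend on the reduced expression that is chosen.\<close>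

definition artin_lift :: "'i coxeter_matrix \<Rightarrow> 'i list set \<Rightarrow> 'i list set" where
  "artin_lift M w = artin_word M (SOME u. reduced_expression M w u)"

text \<open>The longest element of the subgroup generated by the \<open>s\<^sub>k\<close>, \<open>k \<in> K\<close>; it is only meaningful when
  this subgroup is finite, in which case it is unique.\<close>

definition longest_element :: "'i coxeter_matrix \<Rightarrow> 'i set \<Rightarrow> 'i list set" where
  "longest_element M K =
     arg_max_on (coxeter_length M) (generate (coxeter_group M) (coxeter_gen M ` K))"

abbreviation T_longest :: "'i coxeter_matrix \<Rightarrow> 'i set \<Rightarrow> 'i list set" where
  "T_longest M K \<equiv> artin_lift M (longest_element M K)"

definition orthogonal :: "'i coxeter_matrix \<Rightarrow> 'i set \<Rightarrow> 'i set \<Rightarrow> bool" where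
  "orthogonal M J K \<longleftrightarrow> (\<forall>j\<in>J. \<forall>k\<in>K. entry M j k = 2)"

definition weakly_orthogonal :: "'i coxeter_matrix \<Rightarrow> 'i set \<Rightarrow> 'i set \<Rightarrow> bool" where
  "weakly_orthogonal M J K \<longleftrightarrow> orthogonal M (J - K) K \<and> orthogonal M (K - J) J"

section \<open>The classical series\<close>

text \<open>Nodes are integers, so that intervals such as \<open>{1..m - 1}\<close> are empty for \<open>m = 0\<close>.\<close>

definition type_A :: "int \<Rightarrow> int coxeter_matrix" where
  "type_A n =
     \<lparr>nodes = {1..n},
      entry = (\<lambda>i j. if i = j then 1 else if \<bar>i - j\<bar> = 1 then 3 else 2)\<rparr>"

definition type_B :: "int \<Rightarrow> int coxeter_matrix" where
  "type_B n =
     \<lparr>nodes = {1..n},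
      entry = (\<lambda>i j. if i = j then 1
                     else if {i, j} = {n - 1, n} then 4
                     else if \<bar>i - j\<bar> = 1 then 3 else 2)\<rparr>"

text \<open>The argument is the rank \<open>r = n + 1\<close>: the nodes \<open>1, \<dots>, r - 1\<close> form a chain, and \<open>r\<close> is
  joined to \<open>r - 2\<close> only. Pitfall: in rank \<open>r = 2 m + 1\<close>, \<open>m \<ge> 2\<close>, the node \<open>r\<close> is therefore adjacent to
  \<open>{1..2 m - 1}\<close>, and adding it to this interval destroys the type \<open>B\<^sub>2\<close> braid relation with the
  lift of the longest element of \<open>{m + 1..r}\<close>. Hence a statement about sets \<open>K \<subseteq> {2 m + 1..r}\<close>
  of added nodes has to exclude \<open>r \<in> K\<close> in this rank.\<close>

definition type_D :: "int \<Rightarrow> int coxeter_matrix" where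
  "type_D r =
     \<lparr>nodes = {1..r},
      entry = (\<lambda>i j. if i = j then 1
                     else if {i, j} = {r - 2, r} then 3
                     else if \<bar>i - j\<bar> = 1 \<and> i < r \<and> j < r then 3 else 2)\<rparr>"

lemma enat_2_le_numeral [simp]: "(2::enat) \<le> 3" "(2::enat) \<le> 4"
  by (simp_all add: numeral_eq_enat)

lemma is_coxeter_matrix_type_A: "is_coxeter_matrix (type_A n)"
  by (auto simp: is_coxeter_matrix_def type_A_def)

lemma is_coxeter_matrix_type_B: "is_coxeter_matrix (type_B n)"
  by (auto simp: is_coxeter_matrix_def type_B_def doubleton_eq_iff)

lemma is_coxeter_matrix_type_D: "is_coxeter_matrix (type_D r)"
  by (auto simp: is_coxeter_matrix_def type_D_def doubleton_eq_iff)

section \<open>Presented monoids are monoids, and Coxeter groups are groups\<close>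

lemma word_cong_in_lists:
  assumes "(u, v) \<in> word_cong I R"
  shows "u \<in> lists I" "v \<in> lists I"
  using assms by (induction rule: word_cong.induct) auto

lemma equiv_word_cong: "equiv (lists I) (word_cong I R)"
  by (intro equivI refl_onI symI transI subsetI)
     (auto intro: word_cong.intros dest: word_cong_in_lists)

lemma word_cong_append:
  assumes "(u, v) \<in> word_cong I R" "a \<in> lists I" "b \<in> lists I"
  shows "(a @ u @ b, a @ v @ b) \<in> word_cong I R"
  using assms
proof (induction rule: word_cong.induct)
  case (rel u v c d)
  then have "((a @ c) @ u @ (d @ b), (a @ c) @ v @ (d @ b)) \<in> word_cong I R"
    by (intro word_cong.rel) auto
  then show ?case by simp
next
  case (refl u)
  then show ?case by (intro word_cong.refl) auto
next
  case (sym u v)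
  then show ?case by (meson word_cong.sym)
next
  case (trans u v w)
  then show ?case by (meson word_cong.trans)
qed

lemma word_cong_append2:
  assumes "(u, v) \<in> word_cong I R" "(x, y) \<in> word_cong I R"
  shows "(u @ x, v @ y) \<in> word_cong I R"
proof -
  have "(u @ x, v @ x) \<in> word_cong I R"
    using word_cong_append[OF assms(1), of "[]" x] word_cong_in_lists[OF assms(2)] by simp
  moreover have "(v @ x, v @ y) \<in> word_cong I R"
    using word_cong_append[OF assms(2), of v "[]"] word_cong_in_lists[OF assms(1)] by simp
  ultimately show ?thesis by (rule word_cong.trans)
qed

lemma word_class_eq_iff:
  assumes "u \<in> lists I" "v \<in> lists I"
  shows "word_class I R u = word_class I R v \<longleftrightarrow> (u, v) \<in> word_cong I R"
  unfolding word_class_def using eq_equiv_class_iff[OF equiv_word_cong assms] by simp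

lemma carrier_presented_monoid:
  "carrier (presented_monoid I R) = word_class I R ` lists I"
  by (auto simp: presented_monoid_def quotient_def word_class_def)

lemma one_presented_monoid: "\<one>\<^bsub>presented_monoid I R\<^esub> = word_class I R []"
  by (simp add: presented_monoid_def)

lemma mult_word_class:
  assumes "u \<in> lists I" "v \<in> lists I"
  shows "word_class I R u \<otimes>\<^bsub>presented_monoid I R\<^esub> word_class I R v = word_class I R (u @ v)"
proof -
  have *: "word_class I R (a @ b) = word_class I R (u @ v)"
    if "a \<in> word_class I R u" "b \<in> word_class I R v" for a b
  proof -
    have ab: "(u, a) \<in> word_cong I R" "(v, b) \<in> word_cong I R"
      using that by (auto simp: word_class_def)
    have "(u @ v, a @ b) \<in> word_cong I R" by (rule word_cong_append2[OF ab])
    then have c: "(a @ b, u @ v) \<in> word_cong I R" by (rule word_cong.sym)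
    show ?thesis
      by (rule iffD2[OF word_class_eq_iff c]) (rule word_cong_in_lists[OF c])+
  qed
  have "u \<in> word_class I R u" "v \<in> word_class I R v"
    using assms by (auto simp: word_class_def intro: word_cong.refl)
  moreover have "(\<Union>a\<in>A. \<Union>b\<in>B. f a b) = C"
    if "\<And>a b. a \<in> A \<Longrightarrow> b \<in> B \<Longrightarrow> f a b = C" "x \<in> A" "y \<in> B" 
    for A B C x y and f :: "'a list \<Rightarrow> 'a list \<Rightarrow> 'a list set"
    using that by fast
  ultimately have "(\<Union>a\<in>word_class I R u. \<Union>b\<in>word_class I R v. word_class I R (a @ b))
      = word_class I R (u @ v)"
    using * by meson
  then show ?thesis by (simp add: presented_monoid_def)
qed

lemma monoid_presented_monoid: "monoid (presented_monoid I R)"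
proof (rule monoidI)
  fix x y z
  assume "x \<in> carrier (presented_monoid I R)" "y \<in> carrier (presented_monoid I R)"
    "z \<in> carrier (presented_monoid I R)"
  then obtain u v w where "x = word_class I R u" "y = word_class I R v" "z = word_class I R w"
    "u \<in> lists I" "v \<in> lists I" "w \<in> lists I"
    unfolding carrier_presented_monoid by blast
  then show "x \<otimes>\<^bsub>presented_monoid I R\<^esub> y \<otimes>\<^bsub>presented_monoid I R\<^esub> z =
    x \<otimes>\<^bsub>presented_monoid I R\<^esub> (y \<otimes>\<^bsub>presented_monoid I R\<^esub> z)"
    by (simp add: mult_word_class in_lists_conv_set ball_Un)
qed (auto simp: carrier_presented_monoid one_presented_monoid mult_word_class in_lists_conv_set
    intro!: imageI)

lemma monoid_artin_monoid: "monoid (artin_monoid M)"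
  unfolding artin_monoid_def by (rule monoid_presented_monoid)

lemma coxeter_word_rev:
  assumes "is_coxeter_matrix M" "u \<in> lists (nodes M)"
  shows "(rev u @ u, []) \<in> word_cong (nodes M) (coxeter_relations M)"
  using assms(2)
proof (induction u)
  case Nil
  then show ?case by (simp add: word_cong.refl)
next
  case (Cons i u)
  then have i: "i \<in> nodes M" and u: "u \<in> lists (nodes M)" by auto
  have "entry M i i = enat 1" using assms(1) i by (simp add: is_coxeter_matrix_def one_enat_def)
  then have "(concat (replicate 1 [i, i]), []) \<in> coxeter_relations M"
    unfolding coxeter_relations_def using i by blast
  then have "(rev u @ [i, i] @ u, rev u @ [] @ u) \<in> word_cong (nodes M) (coxeter_relations M)"
    using i u by (intro word_cong.rel) auto
  with Cons u show ?case by (auto intro: word_cong.trans)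
qed

lemma group_coxeter_group:
  assumes "is_coxeter_matrix M"
  shows "group (coxeter_group M)"
proof -
  interpret monoid "coxeter_group M"
    unfolding coxeter_group_def by (rule monoid_presented_monoid)
  show ?thesis
  proof (rule group_l_invI)
    fix x assume "x \<in> carrier (coxeter_group M)"
    then obtain u where u: "u \<in> lists (nodes M)" "x = word_class (nodes M) (coxeter_relations M) u"
      by (auto simp: coxeter_group_def carrier_presented_monoid)
    have "word_class (nodes M) (coxeter_relations M) (rev u) \<otimes>\<^bsub>coxeter_group M\<^esub> x = \<one>\<^bsub>coxeter_group M\<^esub>"
      using u coxeter_word_rev[OF assms u(1)]
      by (simp add: coxeter_group_def mult_word_class one_presented_monoid word_class_eq_iff
            in_lists_conv_set)
    then show "\<exists>y\<in>carrier (coxeter_group M). y \<otimes>\<^bsub>coxeter_group M\<^esub> x = \<one>\<^bsub>coxeter_group M\<^esub>"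
      using u(1) by (auto simp: coxeter_group_def carrier_presented_monoid in_lists_conv_set)
  qed
qed

end

theory Submission
  imports Defs
begin

text \<open>
  A word is read as a play of Mozes' numbers game: a position assigns an integer to every node,
  and the move at a node is legal if its number is positive. Two moves that are both legal can be
  continued along the two sides of their braid relation to a common position, so a terminating play
  absorbs every other legal play from the same position, up to braid relations. Applied to reversed
  words, this gives Matsumoto's theorem, shows that the legal words from a dominant position are
  the reduced ones, and identifies \<open>T\<^sub>w\<close> for the longest element of a parabolic subgroup
  with any terminating play in its letters.

  In types A, B and D positions are sequences that are permuted up to sign, and two words are equal
  in the Artin monoid as soon as both are legal and have the same effect on one sequence. Let
  \<open>A\<close> be the reversal of the first \<open>2 m\<close> entries and \<open>B\<close> the sign change of all but
  the first \<open>m\<close> entries. Then \<open>A = r s = s r\<close>, where \<open>s\<close> exchanges the first two blocks of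
  length \<open>m\<close> and \<open>r\<close> reverses both of them, and \<open>B = y z\<close>, where \<open>y\<close> changes the signs in
  the second block. Since \<open>s y s\<close> changes the signs in the first block, it commutes with \<open>B\<close>,
  and \<open>A B A B = B A B A\<close> follows. Type A is obtained by folding. Finally, the factors that come
  from \<open>J\<close> and \<open>K\<close> can be moved through \<open>A\<close> and \<open>B\<close> by the diagram automorphisms which
  these induce.
\<close>

section \<open>The numbers game\<close>

definition fire :: "('i \<Rightarrow> 'i \<Rightarrow> int) \<Rightarrow> 'i \<Rightarrow> ('i \<Rightarrow> int) \<Rightarrow> 'i \<Rightarrow> int" where
  "fire c i f = (\<lambda>j. f j - c i j * f i)"

fun play :: "('i \<Rightarrow> 'i \<Rightarrow> int) \<Rightarrow> ('i \<Rightarrow> int) \<Rightarrow> 'i list \<Rightarrow> 'i \<Rightarrow> int" where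
  "play c f [] = f"
| "play c f (i # u) = play c (fire c i f) u"

fun legal :: "('i \<Rightarrow> 'i \<Rightarrow> int) \<Rightarrow> ('i \<Rightarrow> int) \<Rightarrow> 'i list \<Rightarrow> bool" where
  "legal c f [] \<longleftrightarrow> True"
| "legal c f (i # u) \<longleftrightarrow> 0 < f i \<and> legal c (fire c i f) u"

lemma play_append [simp]: "play c f (u @ v) = play c (play c f u) v"
  by (induction u arbitrary: f) auto

lemma legal_append [simp]: "legal c f (u @ v) \<longleftrightarrow> legal c f u \<and> legal c (play c f u) v"
  by (induction u arbitrary: f) auto

lemma play_uminus: "play c (\<lambda>j. - f j) u = (\<lambda>j. - play c f u j)"
proof (induction u arbitrary: f)
  case (Cons i u)
  have "fire c i (\<lambda>j. - f j) = (\<lambda>j. - fire c i f j)" by (simp add: fire_def fun_eq_iff)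
  with Cons show ?case by simp
qed simp

lemma play_cong_on:
  assumes "u \<in> lists K" "\<forall>k\<in>K. f k = g k"
  shows "(legal c f u \<longleftrightarrow> legal c g u) \<and> (\<forall>k\<in>K. play c f u k = play c g u k)"
  using assms
proof (induction u arbitrary: f g)
  case (Cons i u)
  then have "i \<in> K" by simp
  then have "fire c i f k = fire c i g k" if "k \<in> K" for k
    using Cons.prems that by (simp add: fire_def)
  moreover have "f i = g i" using \<open>i \<in> K\<close> Cons.prems by simp
  ultimately show ?case using Cons.IH[of "fire c i f" "fire c i g"] Cons.prems by auto
qed simp

text \<open>Substituting words for letters respects the congruences as soon as it respects the
  relations; \<open>B2_hom\<close> is well defined for this reason.\<close>

lemma word_cong_map:
  assumes "(u, v) \<in> word_cong I R" "\<And>i. i \<in> I \<Longrightarrow> \<phi> i \<in> lists I'"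
    "\<And>a b. (a, b) \<in> R \<Longrightarrow> a \<in> lists I \<Longrightarrow> b \<in> lists I
       \<Longrightarrow> (concat (map \<phi> a), concat (map \<phi> b)) \<in> word_cong I' R'"
  shows "(concat (map \<phi> u), concat (map \<phi> v)) \<in> word_cong I' R'"
proof -
  have l: "concat (map \<phi> w) \<in> lists I'" if "w \<in> lists I" for w
    using that assms(2) by (induction w) auto
  show ?thesis using assms(1)
  proof (induction rule: word_cong.induct)
    case (rel u v a b)
    then show ?case using assms(3) word_cong_append[OF _ l[of a] l[of b]] by simp
  next
    case (refl u)
    then show ?case by (intro word_cong.refl l)
  qed (blast intro: word_cong.sym word_cong.trans)+
qed

text \<open>Entries 2, 3 and 4 cover types A, B and D and allow integral Cartan matrices. For entry
  4 it is left open which of the two numbers is \<open>-2\<close>.\<close>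

locale cartan_datum =
  fixes M :: "'i coxeter_matrix" and c :: "'i \<Rightarrow> 'i \<Rightarrow> int"
  assumes coxeter: "is_coxeter_matrix M"
    and diag: "i \<in> nodes M \<Longrightarrow> c i i = 2"
    and off_diag: "\<lbrakk>i \<in> nodes M; j \<in> nodes M; i \<noteq> j\<rbrakk> \<Longrightarrow>
      entry M i j = 2 \<and> c i j = 0 \<and> c j i = 0 \<or>
      entry M i j = 3 \<and> c i j = -1 \<and> c j i = -1 \<or>
      entry M i j = 4 \<and> c i j * c j i = 2 \<and> c i j < 0"
begin

abbreviation braid_eq (infix "\<approx>" 50) where
  "u \<approx> v \<equiv> (u, v) \<in> word_cong (nodes M) (braid_relations M)"

abbreviation coxeter_eq (infix "\<approx>\<^sub>W" 50) where
  "u \<approx>\<^sub>W v \<equiv> (u, v) \<in> word_cong (nodes M) (coxeter_relations M)"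

lemma entry_cases:
  assumes "i \<in> nodes M" "j \<in> nodes M" "i \<noteq> j" "entry M i j = enat k"
  obtains "k = 2" "c i j = 0" "c j i = 0" | "k = 3" "c i j = -1" "c j i = -1"
    | "k = 4" "c i j = -1" "c j i = -2" | "k = 4" "c i j = -2" "c j i = -1"
proof -
  have "c i j = -1 \<and> c j i = -2 \<or> c i j = -2 \<and> c j i = -1" if "c i j * c j i = 2" "c i j < 0"
  proof -
    have "c i j dvd 2" using that(1) by (metis dvd_triv_left)
    then have "\<bar>c i j\<bar> \<le> 2" by (simp add: zdvd_imp_le)
    with that(2) have "c i j = -1 \<or> c i j = -2" by linarith
    with that(1) show ?thesis by auto
  qed
  with off_diag[OF assms(1-3)] assms(4) that show thesis
    by (auto simp: numeral_eq_enat)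
qed

lemma entry_finite:
  assumes "i \<in> nodes M" "j \<in> nodes M" "i \<noteq> j"
  obtains k where "entry M i j = enat k" "2 \<le> k"
  using off_diag[OF assms] that by (auto simp: numeral_eq_enat)

text \<open>In rank two the numbers fired along one side of the braid relation are the values of the
  positive roots at \<open>f\<close>. The first and the last are \<open>f i\<close> and
  \<open>f j\<close> in some order and the others are positive combinations of them, whence the
  criterion for legality.\<close>

lemma alternating_play:
  assumes "i \<in> nodes M" "j \<in> nodes M" "i \<noteq> j" "entry M i j = enat k"
  shows "play c f (alternating i j k) = play c f (alternating j i k)"
    and "legal c f (alternating i j k) \<longleftrightarrow> 0 < f i \<and> 0 < f j"
    and "legal c f (alternating j i k) \<longleftrightarrow> 0 < f i \<and> 0 < f j"
    and "play c f (concat (replicate k [i, j])) = f"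
  using entry_cases[OF assms] diag[OF assms(1)] diag[OF assms(2)]
  by (cases; auto simp: numeral_eq_Suc fire_def fun_eq_iff algebra_simps)+

text \<open>A position on one wall still admits \<open>k - 1\<close> legal moves, one for each
  positive root that does not vanish there, and they end on a wall again. This drives the descent in
  \<open>nonzero_start\<close>.\<close>

lemma alternating_zero:
  assumes "i \<in> nodes M" "j \<in> nodes M" "i \<noteq> j" "entry M i j = enat k" "f i = 0" "0 < f j"
  shows "legal c f (alternating j i (k - 1)) \<and>
    (play c f (alternating j i (k - 1)) i = 0 \<or> play c f (alternating j i (k - 1)) j = 0)"
  using entry_cases[OF assms(1-4)] diag[OF assms(1)] diag[OF assms(2)] assms(5,6)
  by (cases; auto simp: numeral_eq_Suc fire_def)

lemma alternating_lists: "i \<in> K \<Longrightarrow> j \<in> K \<Longrightarrow> alternating i j k \<in> lists K"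
  by (induction k arbitrary: i j) auto

lemma length_alternating [simp]: "length (alternating i j k) = k"
  by (induction k arbitrary: i j) auto

lemma set_alternating: "2 \<le> k \<Longrightarrow> set (alternating i j k) = {i, j}"
proof (induction k arbitrary: i j rule: dec_induct)
  case base
  then show ?case by (simp add: numeral_eq_Suc)
next
  case (step n)
  then show ?case using step.IH[of j i] by auto
qed

lemma braid_relation:
  assumes "i \<in> nodes M" "j \<in> nodes M" "i \<noteq> j" "entry M i j = enat k"
  shows "alternating i j k \<approx> alternating j i k"
proof -
  have "(alternating i j k, alternating j i k) \<in> braid_relations M"
    unfolding braid_relations_def using assms by blast
  from word_cong.rel[OF this, of "nodes M" "[]" "[]"] show ?thesis
    using assms alternating_lists[of _ "nodes M"] by simp
qed

lemma fire_fire: "i \<in> nodes M \<Longrightarrow> fire c i (fire c i f) = f"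
  using diag[of i] by (auto simp: fire_def fun_eq_iff)

section \<open>Invariance of plays under the braid and Coxeter relations\<close>

lemma braid_eq_invariants:
  assumes "u \<approx> v"
  shows "play c f u = play c f v" "legal c f u \<longleftrightarrow> legal c f v" "length u = length v"
    "set u = set v" "rev u \<approx> rev v" "u \<approx>\<^sub>W v"
proof -
  have "(\<forall>f. play c f u = play c f v) \<and> (\<forall>f. legal c f u \<longleftrightarrow> legal c f v) \<and> length u = length v
    \<and> set u = set v \<and> rev u \<approx> rev v \<and> u \<approx>\<^sub>W v"
    using assms
  proof (induction rule: word_cong.induct)
    case (rel u v a b)
    then obtain i j k where *: "u = alternating i j k" "v = alternating j i k"
      "i \<in> nodes M" "j \<in> nodes M" "i \<noteq> j" "entry M i j = enat k"
      by (auto simp: braid_relations_def)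
    have k: "k = 2 \<or> k = 3 \<or> k = 4" using entry_cases[OF *(3-6)] by metis
    have "rev u \<approx> rev v"
    proof -
      \<comment> \<open>The first case is that of odd \<open>k\<close>, the second that of even
        \<open>k\<close>.\<close>
      have "rev u = u \<and> rev v = v \<or> rev u = v \<and> rev v = u"
        using k * by (auto simp: numeral_eq_Suc)
      then show ?thesis using braid_relation[OF *(3-6)] * word_cong.sym by metis
    qed
    then have "rev (a @ u @ b) \<approx> rev (a @ v @ b)"
      using word_cong_append[of "rev u" "rev v" _ _ "rev b" "rev a"] rel
      by (simp add: in_lists_conv_set)
    moreover have "u \<approx>\<^sub>W v"
    proof -
      have r: "concat (replicate k [i, j]) \<approx>\<^sub>W []"
      proof -
        have "(concat (replicate k [i, j]), []) \<in> coxeter_relations M"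
          unfolding coxeter_relations_def using * by blast
        from word_cong.rel[OF this, of "nodes M" "[]" "[]"] show ?thesis
          using * by (auto simp: in_lists_conv_set)
      qed
      \<comment> \<open>For either parity \<open>rev v\<close> continues the alternation of
        \<open>u\<close>. The Coxeter relation thus cancels \<open>u @ rev v\<close>, while
        \<open>rev v\<close> also cancels against \<open>v\<close>.\<close>
      have uv: "u @ rev v = concat (replicate k [i, j])"
        using k * by (auto simp: numeral_eq_Suc)
      have "u @ rev v @ v \<approx>\<^sub>W u @ []"
        using word_cong_append2[OF word_cong.refl coxeter_word_rev[OF coxeter]] rel by blast
      moreover have "(u @ rev v) @ v \<approx>\<^sub>W [] @ v"
        using word_cong_append2[OF r word_cong.refl] rel uv by metis
      ultimately show ?thesis by (simp add: word_cong.sym) (metis word_cong.sym word_cong.trans)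
    qed
    then have "a @ u @ b \<approx>\<^sub>W a @ v @ b" using rel word_cong_append by metis
    moreover have "set u = set v"
      using set_alternating[of k i j] set_alternating[of k j i] k *(1,2) by force
    ultimately show ?case
      using * alternating_play[OF *(3-6)] rel by simp
  qed (auto intro: word_cong.refl word_cong.sym word_cong.trans)
  then show "play c f u = play c f v" "legal c f u \<longleftrightarrow> legal c f v" "length u = length v"
    "set u = set v" "rev u \<approx> rev v" "u \<approx>\<^sub>W v" by blast+
qed

lemma coxeter_eq_play:
  assumes "u \<approx>\<^sub>W v" shows "play c f u = play c f v"
proof -
  have "\<forall>f. play c f u = play c f v"
    using assms
  proof (induction rule: word_cong.induct)
    case (rel u v a b)
    then obtain i j k where *: "u = concat (replicate k [i, j])" "v = []"
      "i \<in> nodes M" "j \<in> nodes M" "entry M i j = enat k"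
      by (auto simp: coxeter_relations_def)
    have "play c f u = f" for f
    proof (cases "i = j")
      case True
      then have "k = 1" using * coxeter by (auto simp: is_coxeter_matrix_def one_enat_def)
      then show ?thesis using True * by (simp add: fire_fire)
    next
      case False
      then show ?thesis using alternating_play(4)[of i j k f] * by simp
    qed
    then show ?case using * by simp
  qed auto
  then show ?thesis by blast
qed

section \<open>Strong convergence and Matsumoto's theorem\<close>

text \<open>Induction on the length of the terminating play. If the first letters differ, both are
  legal moves, so both sides of their braid relation are legal, and the two plays are compared
  through its common end. The restriction to \<open>K\<close> makes the result available for
  parabolic subgroups.\<close>

lemma strong_convergence:
  assumes "K \<subseteq> nodes M" "u \<in> lists K" "legal c f u" "\<forall>k\<in>K. play c f u k \<le> 0"
    "v \<in> lists K" "legal c f v"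
  shows "\<exists>x\<in>lists K. v @ x \<approx> u"
  using assms(2-)
proof (induction "length u" arbitrary: u v f rule: less_induct)
  case less
  have inn: "w \<in> lists (nodes M)" if "w \<in> lists K" for w using that assms(1) by auto
  have eq_lists: "w \<in> lists K" if "w \<approx> w'" "w' \<in> lists K" for w w'
    using braid_eq_invariants(4)[OF that(1)] that(2) by (simp add: in_lists_conv_set)
  show ?case
  proof (cases v)
    case Nil
    then show ?thesis using less.prems inn word_cong.refl by fastforce
  next
    case v: (Cons j v')
    then have j: "j \<in> K" "0 < f j" using less.prems by auto
    show ?thesis
    proof (cases u)
      case Nil
      then show ?thesis using less.prems j by fastforce
    next
      case u: (Cons i u')
      then have i: "i \<in> K" "0 < f i" using less.prems by auto
      show ?thesis
      proof (cases "i = j")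
        case True
        obtain x where "x \<in> lists K" "v' @ x \<approx> u'"
          using less.hyps[of u' "fire c i f" v'] less.prems u v True by auto
        then show ?thesis
          using word_cong_append[of "v' @ x" u' _ _ "[i]" "[]"] i assms(1) u v True
          by (intro bexI[of _ x]) auto
      next
        case False
        obtain k where k: "entry M i j = enat k" "2 \<le> k"
          using entry_finite[of i j] i j assms(1) False by blast
        then obtain k' where k': "k = Suc k'" by (cases k) auto
        note ij = subsetD[OF assms(1) i(1)] subsetD[OF assms(1) j(1)] False k(1)
        have "legal c f (alternating i j k)" "legal c f (alternating j i k)"
          using alternating_play(2,3)[OF ij, of f] i j by auto
        then have lij: "legal c (fire c i f) (alternating j i k')"
          and lji: "legal c (fire c j f) (alternating i j k')"
          by (auto simp: k')
        obtain x where x: "x \<in> lists K" "alternating j i k' @ x \<approx> u'"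
          using less.hyps[of u' "fire c i f" "alternating j i k'"] less.prems u lij
            alternating_lists[of j K i k'] i j by auto
        define u2 where "u2 = alternating i j k' @ x"
        have u2: "u \<approx> j # u2"
        proof -
          have "[i] @ (alternating j i k' @ x) @ [] \<approx> [i] @ u' @ []"
            using word_cong_append[OF x(2)] ij by (metis lists.Nil lists.Cons)
          then have "alternating i j k @ x \<approx> u" using u by (simp add: k')
          moreover have "alternating i j k @ x \<approx> alternating j i k @ x"
            using word_cong_append2[OF braid_relation[OF ij] word_cong.refl[OF inn[OF x(1)]]] .
          ultimately have "u \<approx> alternating j i k @ x"
            using word_cong.sym word_cong.trans by metis
          then show ?thesis by (simp add: u2_def k')
        qed
        have l: "length u2 < length u" using braid_eq_invariants(3)[OF u2] by simp
        have u2K: "u2 \<in> lists K" using x alternating_lists[of i K j] i j by (simp add: u2_def)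
        have "legal c f (j # u2)" "play c f (j # u2) = play c f u"
          using braid_eq_invariants(1,2)[OF u2, of f] less.prems by auto
        then obtain y where y: "y \<in> lists K" "v' @ y \<approx> u2"
          using less.hyps[OF l u2K, of "fire c j f" v'] less.prems v by auto
        have "[j] @ (v' @ y) @ [] \<approx> [j] @ u2 @ []"
          using word_cong_append[OF y(2)] ij by (metis lists.Nil lists.Cons)
        then have "v @ y \<approx> u" using u2 v word_cong.sym word_cong.trans by fastforce
        then show ?thesis using y by blast
      qed
    qed
  qed
qed

text \<open>A fired number changes its sign, so it is positive again in the negated position, and
  firing the same node there undoes the move.\<close>

lemma legal_rev:
  assumes "u \<in> lists (nodes M)" "legal c f u"
  shows "legal c (\<lambda>j. - play c f u j) (rev u)"
    and "play c (\<lambda>j. - play c f u j) (rev u) = (\<lambda>j. - f j)"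
proof -
  have "legal c (\<lambda>j. - play c f u j) (rev u) \<and> play c (\<lambda>j. - play c f u j) (rev u) = (\<lambda>j. - f j)"
    using assms
  proof (induction u arbitrary: f)
    case (Cons i u)
    then have *: "legal c (\<lambda>j. - play c f (i # u) j) (rev u)"
      "play c (\<lambda>j. - play c f (i # u) j) (rev u) = (\<lambda>j. - fire c i f j)" by auto
    have "fire c i (\<lambda>j. - fire c i f j) = (\<lambda>j. - f j)"
      using play_uminus[of c "fire c i f" "[i]"] fire_fire[of i f] Cons.hyps(1)
      by (simp add: fun_eq_iff)
    moreover have "0 < - fire c i f i" using Cons.hyps(1) Cons.prems diag[of i] by (auto simp: fire_def)
    ultimately show ?case using * by simp
  qed simp
  then show "legal c (\<lambda>j. - play c f u j) (rev u)"
    "play c (\<lambda>j. - play c f u j) (rev u) = (\<lambda>j. - f j)" by auto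
qed

text \<open>Played backwards from the negated end, both words terminate on \<open>K\<close>, because
  \<open>f\<close> is nonnegative there. Strong convergence completes one to the other, and the
  completion must be empty.\<close>

lemma matsumoto:
  assumes "K \<subseteq> nodes M" "\<forall>k\<in>K. 0 \<le> f k" "u \<in> lists K" "legal c f u" "v \<in> lists K" "legal c f v"
    "\<forall>k\<in>K. play c f u k = play c f v k"
  shows "u \<approx> v"
proof -
  have n: "u \<in> lists (nodes M)" "v \<in> lists (nodes M)" using assms by auto
  define g where "g = (\<lambda>j. - play c f u j)"
  have u: "legal c g (rev u)" "play c g (rev u) = (\<lambda>j. - f j)"
    using legal_rev[OF n(1) assms(4)] by (auto simp: g_def)
  have vK: "rev v \<in> lists K" "rev u \<in> lists K" using assms by (auto simp: in_lists_conv_set)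
  \<comment> \<open>The ends of \<open>u\<close> and \<open>v\<close> agree on \<open>K\<close>
    only, which suffices for words in \<open>K\<close>.\<close>
  have "\<forall>k\<in>K. g k = - play c f v k" using assms(7) by (simp add: g_def)
  from play_cong_on[OF vK(1) this, where c = c] have v: "legal c g (rev v)"
    using legal_rev[OF n(2) assms(6)] by auto
  obtain x where x: "x \<in> lists K" "rev v @ x \<approx> rev u"
    using strong_convergence[OF assms(1) vK(2) u(1) _ vK(1) v] u(2) assms(2) by auto
  have "\<forall>k\<in>K. - play c f v k = g k" using assms(7) by (simp add: g_def)
  from play_cong_on[OF vK(1) this, where c = c]
  have pv: "\<forall>k\<in>K. play c g (rev v) k \<le> 0"
    using legal_rev(2)[OF n(2) assms(6)] assms(2) by fastforce
  have "x = []"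
  proof (cases x)
    case (Cons i x')
    have "legal c g (rev v @ x)" using braid_eq_invariants(2)[OF x(2)] u(1) by simp
    then have "0 < play c g (rev v) i" "i \<in> K" using Cons x(1) by auto
    then show ?thesis using pv by fastforce
  qed
  then show ?thesis using braid_eq_invariants(5)[OF x(2)] by (auto intro: word_cong.sym)
qed

section \<open>Regularity, exchange and reduction of words\<close>

text \<open>Suppose \<open>f i = 0\<close> and \<open>u\<close> begins with \<open>j\<close>. By
  \<open>alternating_zero\<close> and strong convergence \<open>u\<close> can be rewritten to begin
  with \<open>k - 1\<close> alternating moves; what remains is a shorter play whose start again has
  a zero in \<open>K\<close>.\<close>

lemma nonzero_start:
  assumes "K \<subseteq> nodes M" "u \<in> lists K" "legal c f u" "\<forall>k\<in>K. play c f u k < 0" "i \<in> K"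
  shows "f i \<noteq> 0"
  using assms(2-)
proof (induction "length u" arbitrary: u f i rule: less_induct)
  case less
  show ?case
  proof (cases u)
    case Nil
    then show ?thesis using less.prems by fastforce
  next
    case u: (Cons j u')
    show ?thesis
    proof
      assume z: "f i = 0"
      have j: "j \<in> K" "0 < f j" using less.prems u by auto
      with z have ij: "i \<noteq> j" by auto
      obtain k where k: "entry M i j = enat k" "2 \<le> k"
        using entry_finite[of i j] less.prems j assms(1) ij by blast
      then obtain k' where k': "k = Suc (Suc k')" by (metis add_2_eq_Suc le_Suc_ex)
      have az: "legal c f (alternating j i (k - 1))"
        "play c f (alternating j i (k - 1)) i = 0 \<or> play c f (alternating j i (k - 1)) j = 0"
        using alternating_zero[of i j k f] less.prems(4) j assms(1) ij k z by blast+
      then have "legal c (fire c j f) (alternating i j k')" by (simp add: k')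
      moreover have "\<forall>k\<in>K. play c (fire c j f) u' k \<le> 0" using less.prems u by fastforce
      ultimately obtain x where x: "x \<in> lists K" "alternating i j k' @ x \<approx> u'"
        using strong_convergence[OF assms(1), of u' "fire c j f" "alternating i j k'"]
          less.prems u alternating_lists[of i K j k'] j by auto
      define p where "p = play c f (alternating j i (k - 1))"
      have "length x < length u" using braid_eq_invariants(3)[OF x(2)] u by simp
      moreover have "legal c p x" "play c p x = play c f u"
        using braid_eq_invariants(1,2)[OF x(2), of "fire c j f"] less.prems u
        by (auto simp: p_def k')
      ultimately have "p i \<noteq> 0" "p j \<noteq> 0"
        using less.hyps[of x p] x(1) less.prems j by auto
      then show False using az(2) by (simp add: p_def)
    qed
  qed
qed

text \<open>This stands in for the dichotomy of positive and negative roots: after a legal play from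
  a strictly positive position, the next letter is either legal or, by \<open>descent\<close>,
  cancels.\<close>

lemma nonzero:
  assumes "K \<subseteq> nodes M" "\<forall>k\<in>K. 0 < f k" "u \<in> lists K" "legal c f u" "i \<in> K"
  shows "play c f u i \<noteq> 0"
proof -
  have "u \<in> lists (nodes M)" "rev u \<in> lists K" using assms by (auto simp: in_lists_conv_set)
  then show ?thesis
    using nonzero_start[OF assms(1), of "rev u" "\<lambda>j. - play c f u j" i] legal_rev[of u f] assms
    by auto
qed

text \<open>The exchange condition: at the negated end the move \<open>i\<close> is legal, so by
  strong convergence the reversed word can be made to begin with \<open>i\<close>.\<close>

lemma descent:
  assumes "K \<subseteq> nodes M" "\<forall>k\<in>K. 0 \<le> f k" "u \<in> lists K" "legal c f u" "i \<in> K" "play c f u i < 0"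
  obtains v where "v \<in> lists K" "u \<approx> v @ [i]" "legal c f v"
proof -
  have n: "u \<in> lists (nodes M)" "rev u \<in> lists K" using assms by (auto simp: in_lists_conv_set)
  obtain x where x: "x \<in> lists K" "[i] @ x \<approx> rev u"
    using strong_convergence[OF assms(1) n(2), of "\<lambda>j. - play c f u j" "[i]"]
      legal_rev[OF n(1) assms(4)] assms by auto
  then have "u \<approx> rev x @ [i]" using braid_eq_invariants(5)[OF x(2)] word_cong.sym by fastforce
  moreover have "legal c f (rev x)" using braid_eq_invariants(2)[OF calculation] assms(4) by auto
  ultimately show thesis using that[of "rev x"] x(1) by (simp add: in_lists_conv_set)
qed

lemma reduce_snoc:
  assumes "K \<subseteq> nodes M" "\<forall>k\<in>K. 0 < f k" "u \<in> lists K" "legal c f u" "i \<in> K"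
  shows "legal c f (u @ [i]) \<or>
    (\<exists>v\<in>lists K. legal c f v \<and> length v < length (u @ [i]) \<and> u @ [i] \<approx>\<^sub>W v)"
proof (cases "0 < play c f u i")
  case False
  then have "play c f u i < 0" using nonzero[OF assms] by linarith
  moreover have "\<forall>k\<in>K. 0 \<le> f k" using assms(2) by fastforce
  ultimately obtain v where v: "v \<in> lists K" "u \<approx> v @ [i]" "legal c f v"
    using descent[OF assms(1) _ assms(3-5)] by blast
  have i: "i \<in> nodes M" and vn: "v \<in> lists (nodes M)" using assms v by auto
  have "u @ [i] \<approx>\<^sub>W (v @ [i]) @ [i]"
    using word_cong_append2[OF braid_eq_invariants(6)[OF v(2)] word_cong.refl[of "[i]"]] i by simp
  moreover have "v @ (rev [i] @ [i]) \<approx>\<^sub>W v @ []"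
    by (rule word_cong_append2[OF word_cong.refl[OF vn] coxeter_word_rev[OF coxeter]]) (use i in auto)
  ultimately have "u @ [i] \<approx>\<^sub>W v" by (auto intro: word_cong.trans)
  moreover have "length v < length (u @ [i])" using braid_eq_invariants(3)[OF v(2)] by simp
  ultimately show ?thesis using v by blast
qed (use assms in auto)

lemma reduce:
  assumes "K \<subseteq> nodes M" "\<forall>k\<in>K. 0 < f k" "u \<in> lists K"
  shows "legal c f u \<or> (\<exists>v\<in>lists K. legal c f v \<and> length v < length u \<and> u \<approx>\<^sub>W v)"
  using assms(3)
proof (induction u rule: rev_induct)
  case (snoc i u)
  then have i: "i \<in> K" "u \<in> lists K" by auto
  then consider "legal c f u" | v where "v \<in> lists K" "legal c f v" "length v < length u" "u \<approx>\<^sub>W v"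
    using snoc.IH by blast
  then show ?case
  proof cases
    case 1
    then show ?thesis using reduce_snoc[OF assms(1,2) i(2) _ i(1)] by blast
  next
    case 2
    have *: "u @ [i] \<approx>\<^sub>W v @ [i]"
      using word_cong_append2[OF 2(4) word_cong.refl[of "[i]"]] i assms(1) by auto
    from reduce_snoc[OF assms(1,2) 2(1,2) i(1)] show ?thesis
    proof
      assume "legal c f (v @ [i])"
      then show ?thesis using 2 * i by (intro disjI2 bexI[of _ "v @ [i]"]) auto
    next
      assume "\<exists>w\<in>lists K. legal c f w \<and> length w < length (v @ [i]) \<and> v @ [i] \<approx>\<^sub>W w"
      then obtain w where "w \<in> lists K" "legal c f w" "length w < length (v @ [i])" "v @ [i] \<approx>\<^sub>W w"
        by blast
      then show ?thesis using 2 word_cong.trans[OF *]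
        by (intro disjI2 bexI[of _ w]) auto
    qed
  qed
qed simp

text \<open>Here legality of \<open>v\<close> follows by counting. Otherwise \<open>v\<close> would
  reduce to a legal word shorter than \<open>u\<close> with the same effect, and
  \<open>matsumoto\<close> forces such a word to have the length of \<open>u\<close>.\<close>

lemma matsumoto_length:
  assumes "K \<subseteq> nodes M" "\<forall>k\<in>K. 0 < f k" "u \<in> lists K" "legal c f u" "v \<in> lists K"
    "length v \<le> length u" "\<forall>k\<in>K. play c f u k = play c f v k"
  shows "u \<approx> v"
proof -
  have f: "\<forall>k\<in>K. 0 \<le> f k" using assms(2) by fastforce
  from reduce[OF assms(1,2,5)] show ?thesis
  proof
    assume "legal c f v"
    then show ?thesis using matsumoto[OF assms(1) f assms(3-5)] assms(7) by blast
  next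
    assume "\<exists>w\<in>lists K. legal c f w \<and> length w < length v \<and> v \<approx>\<^sub>W w"
    then obtain w where w: "w \<in> lists K" "legal c f w" "length w < length v" "v \<approx>\<^sub>W w" by blast
    then have "u \<approx> w" using matsumoto[OF assms(1) f assms(3,4) w(1,2)] assms(7) coxeter_eq_play[OF w(4)]
      by simp
    then show ?thesis using braid_eq_invariants(3) w(3) assms(6) by fastforce
  qed
qed

section \<open>Reduced words and longest elements\<close>


lemma artin_word_eq_iff:
  assumes "u \<in> lists (nodes M)" "v \<in> lists (nodes M)"
  shows "artin_word M u = artin_word M v \<longleftrightarrow> u \<approx> v"
  unfolding artin_word_def by (rule word_class_eq_iff[OF assms])

lemma coxeter_word_eq_iff:
  assumes "u \<in> lists (nodes M)" "v \<in> lists (nodes M)"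
  shows "coxeter_word M u = coxeter_word M v \<longleftrightarrow> u \<approx>\<^sub>W v"
  unfolding coxeter_word_def by (rule word_class_eq_iff[OF assms])

lemma coxeter_length_legal:
  assumes "\<forall>i\<in>nodes M. 0 < f i" "u \<in> lists (nodes M)" "legal c f u"
  shows "coxeter_length M (coxeter_word M u) = length u"
  unfolding coxeter_length_def
proof (rule Least_equality)
  show "\<exists>v\<in>lists (nodes M). coxeter_word M v = coxeter_word M u \<and> length v = length u"
    using assms by blast
  fix k
  assume "\<exists>v\<in>lists (nodes M). coxeter_word M v = coxeter_word M u \<and> length v = k"
  then obtain v where v: "v \<in> lists (nodes M)" "coxeter_word M v = coxeter_word M u" "length v = k"
    by blast
  have "v \<approx>\<^sub>W u" using coxeter_word_eq_iff[OF v(1) assms(2)] v(2) by blast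
  then have "play c f v = play c f u" by (rule coxeter_eq_play)
  then have "length v < length u \<Longrightarrow> u \<approx> v"
    using matsumoto_length[OF order_refl assms(1-3) v(1)] by simp
  then show "length u \<le> k" using braid_eq_invariants(3)[of u v] v(3) by linarith
qed

text \<open>The right-hand side does not mention \<open>f\<close>, so legality is the same for all
  strictly positive starts; \<open>is_longestI\<close> exploits this.\<close>

lemma legal_iff_reduced:
  assumes "\<forall>i\<in>nodes M. 0 < f i" "u \<in> lists (nodes M)"
  shows "legal c f u \<longleftrightarrow> coxeter_length M (coxeter_word M u) = length u"
proof
  assume *: "coxeter_length M (coxeter_word M u) = length u"
  show "legal c f u"
  proof (rule ccontr)
    assume "\<not> legal c f u"
    then obtain v where v: "v \<in> lists (nodes M)" "legal c f v" "length v < length u" "u \<approx>\<^sub>W v"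
      using reduce[OF order_refl assms] by blast
    then have "coxeter_word M u = coxeter_word M v" using coxeter_word_eq_iff assms(2) by simp
    then show False using * v coxeter_length_legal[OF assms(1) v(1,2)] by simp
  qed
qed (rule coxeter_length_legal[OF assms])

text \<open>The expression picked by \<open>SOME\<close> is reduced, hence legal, and has the same
  effect as \<open>u\<close>, so \<open>matsumoto\<close> identifies the two.\<close>

lemma artin_lift_legal:
  assumes "\<forall>i\<in>nodes M. 0 < f i" "u \<in> lists (nodes M)" "legal c f u"
  shows "artin_lift M (coxeter_word M u) = artin_word M u"
proof -
  define r where "r = (SOME r. reduced_expression M (coxeter_word M u) r)"
  have "reduced_expression M (coxeter_word M u) u"
    using coxeter_length_legal[OF assms] assms(2) by (simp add: reduced_expression_def)
  then have "reduced_expression M (coxeter_word M u) r" unfolding r_def by (rule someI)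
  then have r: "r \<in> lists (nodes M)" "coxeter_word M r = coxeter_word M u"
    "length r = coxeter_length M (coxeter_word M r)"
    by (auto simp: reduced_expression_def)
  have "legal c f r" using legal_iff_reduced[OF assms(1) r(1)] r(3) by simp
  moreover have "play c f r = play c f u"
    using coxeter_word_eq_iff[OF r(1) assms(2)] r(2) coxeter_eq_play by blast
  ultimately have "r \<approx> u"
    using matsumoto[OF order_refl _ r(1) _ assms(2,3)] assms(1) by fastforce
  then show ?thesis using artin_word_eq_iff[OF r(1) assms(2)] by (simp add: artin_lift_def r_def)
qed

text \<open>The all-ones position serves as a standard start. Every legal word in \<open>K\<close>
  extends to such a \<open>u\<close>, so \<open>u\<close> also witnesses that the parabolic subgroup
  is finite.\<close>

definition is_longest :: "'i set \<Rightarrow> 'i list \<Rightarrow> bool" where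
  "is_longest K u \<longleftrightarrow> K \<subseteq> nodes M \<and> u \<in> lists K \<and> legal c (\<lambda>_. 1) u \<and>
     (\<forall>k\<in>K. play c (\<lambda>_. 1) u k \<le> 0)"

lemma is_longestI:
  assumes "K \<subseteq> nodes M" "\<forall>i\<in>nodes M. 0 < f i" "u \<in> lists K" "legal c f u"
    "\<forall>k\<in>K. play c f u k \<le> 0"
  shows "is_longest K u"
proof -
  have 1: "\<forall>i\<in>nodes M. 0 < (\<lambda>_. 1 :: int) i" by simp
  have eq: "legal c f w \<longleftrightarrow> legal c (\<lambda>_. 1) w" if "w \<in> lists (nodes M)" for w
    using legal_iff_reduced[OF assms(2) that] legal_iff_reduced[OF 1 that] by simp
  have "u \<in> lists (nodes M)" using assms by auto
  moreover from this have "u @ [k] \<in> lists (nodes M)" if "k \<in> K" for k using that assms(1) by auto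
  \<comment> \<open>Termination is restated as illegality of every extension \<open>u @ [k]\<close>,
    because legality is what passes from \<open>f\<close> to the all-ones position.\<close>
  ultimately have "legal c (\<lambda>_. 1) u" "\<forall>k\<in>K. \<not> legal c (\<lambda>_. 1) (u @ [k])"
    using assms(4,5) eq[of u] eq[of "u @ [_]"] by fastforce+
  then show ?thesis using assms(1,3) by (auto simp: is_longest_def not_less)
qed

lemma is_longest_lists:
  assumes "is_longest K u" shows "u \<in> lists K" "u \<in> lists (nodes M)" "K \<subseteq> nodes M"
  using assms by (auto simp: is_longest_def)

lemma is_longest_extend:
  assumes "is_longest K u" "v \<in> lists K" "legal c (\<lambda>_. 1) v"
  obtains x where "x \<in> lists K" "v @ x \<approx> u"
  using strong_convergence[of K u "\<lambda>_. 1" v] assms by (auto simp: is_longest_def)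

lemma is_longest_unique:
  assumes "is_longest K u" "is_longest K v"
  shows "u \<approx> v"
proof -
  obtain x where x: "x \<in> lists K" "v @ x \<approx> u"
    using is_longest_extend[OF assms(1), of v] assms(2) by (auto simp: is_longest_def)
  obtain y where y: "y \<in> lists K" "u @ y \<approx> v"
    using is_longest_extend[OF assms(2), of u] assms(1) by (auto simp: is_longest_def)
  have "length x = 0"
    using braid_eq_invariants(3)[OF x(2)] braid_eq_invariants(3)[OF y(2)]
    unfolding length_append by linarith
  then show ?thesis using x by (simp add: word_cong.sym)
qed

text \<open>Each generator is its own inverse, so words without inverses exhaust the
  subgroup.\<close>

lemma generate_coxeter_gen:
  assumes "K \<subseteq> nodes M"
  shows "generate (coxeter_group M) (coxeter_gen M ` K) = coxeter_word M ` lists K"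
proof
  interpret group "coxeter_group M" by (rule group_coxeter_group[OF coxeter])
  have n: "w \<in> lists (nodes M)" if "w \<in> lists K" for w using that assms by auto
  have mult: "coxeter_word M u \<otimes>\<^bsub>coxeter_group M\<^esub> coxeter_word M v = coxeter_word M (u @ v)"
    if "u \<in> lists K" "v \<in> lists K" for u v
    using n[OF that(1)] n[OF that(2)] unfolding coxeter_group_def coxeter_word_def
    by (rule mult_word_class)
  have one: "\<one>\<^bsub>coxeter_group M\<^esub> = coxeter_word M []"
    unfolding coxeter_group_def coxeter_word_def by (rule one_presented_monoid)
  have carrier: "coxeter_word M u \<in> carrier (coxeter_group M)" if "u \<in> lists K" for u
    using n[OF that] unfolding coxeter_group_def coxeter_word_def carrier_presented_monoid by simp
  show "generate (coxeter_group M) (coxeter_gen M ` K) \<subseteq> coxeter_word M ` lists K"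
  proof
    fix w assume "w \<in> generate (coxeter_group M) (coxeter_gen M ` K)"
    then show "w \<in> coxeter_word M ` lists K"
    proof (induction rule: generate.induct)
      case one
      show ?case unfolding \<open>\<one>\<^bsub>coxeter_group M\<^esub> = coxeter_word M []\<close> by (rule imageI) simp
    next
      case (incl h)
      then show ?case by auto
    next
      case (inv h)
      then obtain k where k: "k \<in> K" "h = coxeter_gen M k" by blast
      then have kl: "[k] \<in> lists K" "[k] \<in> lists (nodes M)" using assms by auto
      have "rev [k] @ [k] \<approx>\<^sub>W []" by (rule coxeter_word_rev[OF coxeter kl(2)])
      then have "coxeter_gen M k \<otimes>\<^bsub>coxeter_group M\<^esub> coxeter_gen M k = \<one>\<^bsub>coxeter_group M\<^esub>"
        using mult[OF kl(1) kl(1)] one coxeter_word_eq_iff[of "[k, k]" "[]"] kl by simp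
      then have "inv\<^bsub>coxeter_group M\<^esub> h = coxeter_gen M k"
        using inv_equality carrier[OF kl(1)] k by blast
      then show ?case using kl(1) by simp
    next
      case (eng h1 h2)
      then obtain u v where "u \<in> lists K" "v \<in> lists K" "h1 = coxeter_word M u" "h2 = coxeter_word M v"
        by blast
      then show ?case using mult[of u v] by auto
    qed
  qed
  show "coxeter_word M ` lists K \<subseteq> generate (coxeter_group M) (coxeter_gen M ` K)"
  proof
    fix w assume "w \<in> coxeter_word M ` lists K"
    then obtain u where u: "u \<in> lists K" "w = coxeter_word M u" by blast
    from u(1) have "coxeter_word M u \<in> generate (coxeter_group M) (coxeter_gen M ` K)"
    proof (induction rule: lists.induct)
      case Nil
      then show ?case using generate.one[of "coxeter_group M"] one by simp
    next
      case (Cons k v)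
      then have "[k] \<in> lists K" by simp
      from mult[OF this Cons(2)] show ?case
        using Cons generate.eng[OF generate.incl] by (metis append_Cons append_Nil imageI)
    qed
    then show "w \<in> generate (coxeter_group M) (coxeter_gen M ` K)" using u by simp
  qed
qed

text \<open>Every element of the parabolic subgroup has a legal word in \<open>K\<close>, which
  strong convergence completes to \<open>u\<close>. The element is shorter unless the completion is
  empty.\<close>

lemma longest_element_eq:
  assumes "is_longest K u"
  shows "longest_element M K = coxeter_word M u"
proof -
  note l = is_longest_lists[OF assms]
  have 1: "\<forall>i\<in>nodes M. 0 < (\<lambda>_. 1 :: int) i" by simp
  have *: "coxeter_length M (coxeter_word M v) < length u \<or> coxeter_word M v = coxeter_word M u"
    if v: "v \<in> lists K" for v
  proof -
    have "\<forall>k\<in>K. 0 < (\<lambda>_. 1 :: int) k" by simp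
    from reduce[OF l(3) this v] obtain v' where v': "v' \<in> lists K" "legal c (\<lambda>_. 1) v'"
      "v' = v \<or> v \<approx>\<^sub>W v'" using v by blast
    have "v \<in> lists (nodes M)" "v' \<in> lists (nodes M)" using v v'(1) l(3) by auto
    then have "coxeter_word M v' = coxeter_word M v"
      using v'(3) coxeter_word_eq_iff by metis
    note v' = v'(1,2) this
    then have vn: "v' \<in> lists (nodes M)" using l(3) by auto
    obtain x where x: "x \<in> lists K" "v' @ x \<approx> u" using is_longest_extend[OF assms v'(1,2)] .
    show ?thesis
    proof (cases "x = []")
      case True
      then have "v' \<approx>\<^sub>W u" using braid_eq_invariants(6)[OF x(2)] by simp
      then have "coxeter_word M v' = coxeter_word M u" using coxeter_word_eq_iff[OF vn l(2)] by blast
      then show ?thesis using v'(3) by simp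
    next
      case False
      then have "length v' < length u" using braid_eq_invariants(3)[OF x(2)] by (cases x) auto
      then show ?thesis using coxeter_length_legal[OF 1 vn v'(2)] v'(3) by simp
    qed
  qed
  have len: "coxeter_length M (coxeter_word M u) = length u"
    using coxeter_length_legal[OF 1 l(2)] assms by (simp add: is_longest_def)
  define S where "S = coxeter_word M ` lists K"
  have u: "is_arg_max (coxeter_length M) (\<lambda>x. x \<in> S) (coxeter_word M u)"
    unfolding is_arg_max_def S_def
  proof (intro conjI notI)
    show "coxeter_word M u \<in> coxeter_word M ` lists K" using l(1) by (rule imageI)
    assume "\<exists>y. y \<in> coxeter_word M ` lists K \<and> coxeter_length M (coxeter_word M u) < coxeter_length M y"
    then show False using * len by fastforce
  qed
  \<comment> \<open>Uniqueness of the maximum pins down the choice made by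
    \<open>arg_max_on\<close>.\<close>
  have "w = coxeter_word M u" if w: "is_arg_max (coxeter_length M) (\<lambda>x. x \<in> S) w" for w
  proof -
    obtain v where v: "v \<in> lists K" "w = coxeter_word M v"
      using w unfolding is_arg_max_def S_def by blast
    have "coxeter_word M u \<in> S" using l(1) unfolding S_def by (rule imageI)
    then have "\<not> coxeter_length M w < coxeter_length M (coxeter_word M u)"
      using w unfolding is_arg_max_def by blast
    then show ?thesis using *[OF v(1)] len v(2) by simp
  qed
  then show ?thesis
    unfolding longest_element_def generate_coxeter_gen[OF l(3)] arg_max_on_def arg_max_def
    using someI[of "is_arg_max (coxeter_length M) (\<lambda>x. x \<in> S)", OF u] by (simp add: S_def)
qed

lemma T_longest_eq:
  assumes "is_longest K u"
  shows "T_longest M K = artin_word M u"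
  using longest_element_eq[OF assms] artin_lift_legal[of "\<lambda>_. 1" u] is_longest_lists[OF assms] assms
  by (simp add: is_longest_def)

text \<open>Legal words in \<open>K\<close> are no longer than \<open>w\<close>, and one of maximal
  length admits no further move.\<close>

lemma is_longest_subset:
  assumes "is_longest L w" "K \<subseteq> L"
  obtains u where "is_longest K u"
proof -
  define P where "P = (\<lambda>u. u \<in> lists K \<and> legal c (\<lambda>_. 1) u)"
  have "P []" by (simp add: P_def)
  moreover have "\<forall>v. P v \<longrightarrow> length v \<le> length w"
  proof (intro allI impI)
    fix v assume "P v"
    then have "v \<in> lists L" "legal c (\<lambda>_. 1) v" using assms(2) by (auto simp: P_def)
    then obtain x where "v @ x \<approx> w" using is_longest_extend[OF assms(1)] by blast
    from braid_eq_invariants(3)[OF this] show "length v \<le> length w" by simp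
  qed
  ultimately obtain u where u: "P u" "\<forall>v. P v \<longrightarrow> length v \<le> length u"
    using ex_has_greatest_nat[of P "[]" length "Suc (length w)"] by (auto simp: less_Suc_eq_le)
  have "\<forall>k\<in>K. play c (\<lambda>_. 1) u k \<le> 0"
  proof
    fix k assume "k \<in> K"
    then show "play c (\<lambda>_. 1) u k \<le> 0" using u(1) u(2)[rule_format, of "u @ [k]"]
      by (force simp: P_def)
  qed
  then show thesis using that[of u] u(1) assms(2) is_longest_lists(3)[OF assms(1)]
    by (auto simp: is_longest_def P_def)
qed

subsection \<open>Commutation\<close>

lemma orthogonal_play:
  assumes "orthogonal M K L" "K \<subseteq> nodes M" "L \<subseteq> nodes M" "u \<in> lists K" "l \<in> L"
  shows "play c f u l = f l"
  using assms(4)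
proof (induction u arbitrary: f rule: lists.induct)
  case (Cons k u)
  have k: "entry M k l = 2" using assms(1,5) Cons(1) by (auto simp: orthogonal_def)
  have "k \<in> nodes M" "l \<in> nodes M" using assms Cons(1) by auto
  moreover from this have "k \<noteq> l" using k coxeter by (auto simp: is_coxeter_matrix_def)
  ultimately have "c k l = 0" using off_diag[of k l] k by auto
  then show ?case using Cons.IH by (simp add: fire_def)
qed simp

lemma orthogonal_sym:
  assumes "orthogonal M K L" "K \<subseteq> nodes M" "L \<subseteq> nodes M"
  shows "orthogonal M L K"
  using assms coxeter unfolding orthogonal_def is_coxeter_matrix_def by (metis subsetD)

lemma swap_words:
  assumes "w \<in> lists (nodes M)" "\<forall>k\<in>K. w @ [k] \<approx> [\<sigma> k] @ w" "K \<subseteq> nodes M" "\<sigma> ` K \<subseteq> nodes M"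
    "u \<in> lists K"
  shows "w @ u \<approx> map \<sigma> u @ w"
  using assms(5)
proof (induction rule: lists.induct)
  case Nil
  then show ?case using assms(1) word_cong.refl by simp
next
  case (Cons k u)
  have u: "u \<in> lists (nodes M)" "[\<sigma> k] \<in> lists (nodes M)" using assms(3,4) Cons by auto
  have "(w @ [k]) @ u \<approx> ([\<sigma> k] @ w) @ u"
    using word_cong_append2[OF _ word_cong.refl[OF u(1)]] assms(2) Cons(1) by blast
  moreover have "[\<sigma> k] @ (w @ u) \<approx> [\<sigma> k] @ (map \<sigma> u @ w)"
    using word_cong_append2[OF word_cong.refl[OF u(2)] Cons.IH] .
  ultimately show ?case by (auto intro: word_cong.trans)
qed

lemma orthogonal_commute:
  assumes "orthogonal M K L" "K \<subseteq> nodes M" "L \<subseteq> nodes M" "u \<in> lists K" "v \<in> lists L"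
  shows "u @ v \<approx> v @ u"
proof -
  have "u @ [l] \<approx> [l] @ u" if l: "l \<in> L" for l
  proof -
    have "[l] @ [k] \<approx> [k] @ [l]" if k: "k \<in> K" for k
    proof -
      have e: "entry M k l = enat 2" using assms(1) k l by (auto simp: orthogonal_def numeral_eq_enat)
      have n: "k \<in> nodes M" "l \<in> nodes M" using k l assms by auto
      then have "k \<noteq> l" using e coxeter by (auto simp: is_coxeter_matrix_def one_enat_def)
      from braid_relation[OF n this e] show ?thesis by (simp add: numeral_eq_Suc word_cong.sym)
    qed
    then show ?thesis using swap_words[of "[l]" K id u] assms l by (auto intro: word_cong.sym)
  qed
  then show ?thesis using swap_words[of u L id v] assms by auto
qed

text \<open>Moves in one of two orthogonal sets do not change the numbers on the other, so the two
  plays can be run one after the other.\<close>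

lemma is_longest_Un:
  assumes "orthogonal M K L" "is_longest K u" "is_longest L v"
  shows "is_longest (K \<union> L) (u @ v)"
proof -
  note lu = is_longest_lists[OF assms(2)] and lv = is_longest_lists[OF assms(3)]
  let ?f = "\<lambda>_. 1 :: int"
  have "\<forall>l\<in>L. ?f l = play c ?f u l" using orthogonal_play[OF assms(1) lu(3) lv(3) lu(1)] by simp
  from play_cong_on[OF lv(1) this, where c = c]
  have "legal c (play c ?f u) v" "\<forall>l\<in>L. play c (play c ?f u) v l \<le> 0"
    using assms(3) by (auto simp: is_longest_def)
  moreover have "\<forall>k\<in>K. play c (play c ?f u) v k \<le> 0"
    using orthogonal_play[OF orthogonal_sym[OF assms(1) lu(3) lv(3)] lv(3) lu(3) lv(1)] assms(2)
    by (simp add: is_longest_def)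
  ultimately show ?thesis using assms(2,3) by (auto simp: is_longest_def)
qed

text \<open>Weak orthogonality makes \<open>K - L\<close>, \<open>L - K\<close> and
  \<open>K \<inter> L\<close> mutually orthogonal. Their longest words \<open>a\<close>,
  \<open>b\<close>, \<open>d\<close> therefore commute, and \<open>u\<close>, \<open>v\<close>
  become \<open>a @ d\<close>, \<open>b @ d\<close>.\<close>

lemma weakly_orthogonal_commute:
  assumes "weakly_orthogonal M K L" "is_longest K u" "is_longest L v"
  shows "u @ v \<approx> v @ u"
proof -
  note lu = is_longest_lists[OF assms(2)] and lv = is_longest_lists[OF assms(3)]
  have wo: "orthogonal M (K - L) L" "orthogonal M (L - K) K"
    using assms(1) by (auto simp: weakly_orthogonal_def)
  obtain d where d: "is_longest (K \<inter> L) d" using is_longest_subset[OF assms(2) Int_lower1] .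
  obtain a where a: "is_longest (K - L) a" using is_longest_subset[OF assms(2) Diff_subset] .
  obtain b where b: "is_longest (L - K) b" using is_longest_subset[OF assms(3) Diff_subset] .
  note l = is_longest_lists(2)[OF d] is_longest_lists(2)[OF a] is_longest_lists(2)[OF b]
  have lK: "d \<in> lists K" "d \<in> lists L" "b \<in> lists L" using d b by (auto simp: is_longest_def)
  have "orthogonal M (K - L) (K \<inter> L)" "orthogonal M (L - K) (K \<inter> L)"
    using wo by (auto simp: orthogonal_def)
  from is_longest_Un[OF this(1) a d] is_longest_Un[OF this(2) b d]
  have "is_longest K (a @ d)" "is_longest L (b @ d)"
    using Un_Diff_Int[of K L] Un_Diff_Int[of L K] Int_commute[of L K] by metis+
  then have u: "u \<approx> a @ d" and v: "v \<approx> b @ d"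
    using is_longest_unique[OF assms(2)] is_longest_unique[OF assms(3)] by blast+
  have ad: "a @ d \<approx> d @ a" and ab: "a @ b \<approx> b @ a"
    using orthogonal_commute[OF wo(1) _ lv(3), of a] a lu lK by (auto simp: is_longest_def)
  have bd: "b @ d \<approx> d @ b"
    using orthogonal_commute[OF wo(2) _ lu(3), of b d] b lv lK by (auto simp: is_longest_def)
  note [trans] = word_cong.trans
  have "u @ v \<approx> (a @ d) @ (b @ d)" by (rule word_cong_append2[OF u v])
  also have "(a @ d) @ (b @ d) \<approx> a @ b @ d @ d"
    using word_cong_append[OF word_cong.sym[OF bd] l(2,1)] by simp
  also have "a @ b @ d @ d \<approx> b @ a @ d @ d"
    using word_cong_append[OF ab, of "[]" "d @ d"] l by simp
  also have "b @ a @ d @ d \<approx> (b @ d) @ (a @ d)"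
    using word_cong_append[OF ad l(3,1)] by simp
  also have "(b @ d) @ (a @ d) \<approx> v @ u"
    by (rule word_cong.sym[OF word_cong_append2[OF v u]])
  finally show ?thesis .
qed


text \<open>In the Coxeter group \<open>h\<close> is an involution with \<open>w h = h' w\<close>, and \<open>w\<close> has a reduced word
  that ends in \<open>h\<close>. If \<open>v\<close> is reduced for \<open>w h\<close>, then both \<open>v h\<close> and \<open>h' v\<close> are reduced for
  \<open>w\<close>.\<close>

lemma conjugate_word:
  assumes f: "\<forall>i\<in>nodes M. 0 < f i" and w: "w \<in> lists (nodes M)" "legal c f w"
    and h: "h \<in> lists (nodes M)" "h' \<in> lists (nodes M)" "length h = length h'"
    and play: "play c f (h' @ w) = play c f (w @ h)" "play c f (w @ h @ h) = play c f w"
    and legal: "legal c (play c f (w @ h)) h"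
  shows "w @ h \<approx> h' @ w"
proof -
  note [trans] = word_cong.trans
  have f': "\<forall>i\<in>nodes M. 0 \<le> f i" using f by fastforce
  have wh: "w @ h \<in> lists (nodes M)" using w h by simp
  obtain v where v: "v \<in> lists (nodes M)" "legal c f v" "w @ h \<approx>\<^sub>W v"
    using reduce[OF order_refl f wh] word_cong.refl[OF wh] wh by metis
  have pv: "play c g v = play c g (w @ h)" for g using coxeter_eq_play[OF v(3)] by simp
  have 1: "v @ h \<approx> w"
    using matsumoto[OF order_refl f' _ _ w, of "v @ h"] v h legal play(2) pv by simp
  \<comment> \<open>Legality of \<open>h' @ v\<close> comes from a comparison of lengths: it is as
    long as \<open>v @ h\<close>, and thus as \<open>w\<close>.\<close>
  have 2: "w \<approx> h' @ v"
  proof (rule matsumoto_length[OF order_refl f w])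
    show "h' @ v \<in> lists (nodes M)" "length (h' @ v) \<le> length w"
      using v h braid_eq_invariants(3)[OF 1] by auto
    show "\<forall>k\<in>nodes M. play c f w k = play c f (h' @ v) k"
      using pv[of "play c f h'"] play by simp
  qed
  have "w @ h \<approx> (h' @ v) @ h" by (rule word_cong_append2[OF 2 word_cong.refl[OF h(1)]])
  also have "(h' @ v) @ h \<approx> h' @ w"
    using word_cong_append2[OF word_cong.refl[OF h(2)] 1] by simp
  finally show ?thesis .
qed

text \<open>Preserving \<open>c\<close> makes \<open>\<sigma>\<close> carry plays to plays, and the
  all-ones position is invariant under relabelling.\<close>

lemma is_longest_image:
  assumes "is_longest K u" "\<sigma> ` K \<subseteq> nodes M" "\<forall>i\<in>K. \<forall>j\<in>K. c (\<sigma> i) (\<sigma> j) = c i j"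
  shows "is_longest (\<sigma> ` K) (map \<sigma> u)"
proof -
  have "(legal c f u \<longleftrightarrow> legal c g (map \<sigma> u)) \<and> (\<forall>k\<in>K. play c f u k = play c g (map \<sigma> u) (\<sigma> k))"
    if "u \<in> lists K" "\<forall>k\<in>K. f k = g (\<sigma> k)" for u f g
    using that
  proof (induction u arbitrary: f g rule: lists.induct)
    case (Cons i u)
    have "\<forall>k\<in>K. fire c i f k = fire c (\<sigma> i) g (\<sigma> k)"
      using Cons assms(3) by (simp add: fire_def)
    from Cons.IH[OF this] show ?case using Cons by simp
  qed simp
  from this[of u "\<lambda>_. 1" "\<lambda>_. 1"] show ?thesis
    using assms(1,2) by (auto simp: is_longest_def)
qed

lemma conjugate_longest:
  assumes "is_longest Q w" "\<forall>k\<in>K. w @ [k] \<approx> [\<sigma> k] @ w" "is_longest K u" "is_longest (\<sigma> ` K) v"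
    "\<forall>i\<in>K. \<forall>j\<in>K. c (\<sigma> i) (\<sigma> j) = c i j"
  shows "w @ u \<approx> v @ w"
proof -
  note l = is_longest_lists[OF assms(3)] is_longest_lists[OF assms(4)] is_longest_lists[OF assms(1)]
  have "w @ u \<approx> map \<sigma> u @ w" using swap_words[OF l(8) assms(2)] l by simp
  moreover have "map \<sigma> u \<approx> v"
    using is_longest_unique[OF is_longest_image[OF assms(3) l(6) assms(5)] assms(4)] .
  ultimately show ?thesis
    using word_cong_append2[OF _ word_cong.refl[OF l(8)]] word_cong.trans by metis
qed

section \<open>The braid relation of type B2\<close>


text \<open>The pair \<open>(p k, q j)\<close> inherits the braid relation from \<open>(p, q)\<close>, because all the factors \<open>k\<close> and
  \<open>j\<close> can be moved to the right end.\<close>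

lemma braid_relation_enlarge:
  assumes l: "p \<in> lists (nodes M)" "q \<in> lists (nodes M)" "j \<in> lists (nodes M)" "j' \<in> lists (nodes M)"
      "k \<in> lists (nodes M)" "k' \<in> lists (nodes M)"
    and pq: "p @ q @ p @ q \<approx> q @ p @ q @ p"
    and j: "p @ j \<approx> j' @ p" "p @ j' \<approx> j @ p" "q @ j \<approx> j @ q" "q @ j' \<approx> j' @ q" "j @ j' \<approx> j' @ j"
    and k: "q @ k \<approx> k' @ q" "q @ k' \<approx> k @ q" "p @ k \<approx> k @ p" "p @ k' \<approx> k' @ p" "k @ k' \<approx> k' @ k"
    and jk: "j @ k \<approx> k @ j" "j @ k' \<approx> k' @ j"
  shows "(p @ k) @ (q @ j) @ (p @ k) @ (q @ j) \<approx> (q @ j) @ (p @ k) @ (q @ j) @ (p @ k)"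
proof -
  note [trans] = word_cong.trans
  note cong = word_cong_append
  note sym = word_cong.sym
  have "p @ k @ q @ j @ p @ k @ q @ j \<approx> p @ q @ k' @ j @ p @ k @ q @ j"
    using cong[OF sym[OF k(2)], of p "j @ p @ k @ q @ j"] l by simp
  also have "p @ q @ k' @ j @ p @ k @ q @ j \<approx> p @ q @ j @ k' @ p @ k @ q @ j"
    using cong[OF sym[OF jk(2)], of "p @ q" "p @ k @ q @ j"] l by simp
  also have "p @ q @ j @ k' @ p @ k @ q @ j \<approx> p @ q @ j @ p @ k' @ k @ q @ j"
    using cong[OF sym[OF k(4)], of "p @ q @ j" "k @ q @ j"] l by simp
  also have "p @ q @ j @ p @ k' @ k @ q @ j \<approx> p @ q @ j @ p @ k' @ q @ k' @ j"
    using cong[OF sym[OF k(2)], of "p @ q @ j @ p @ k'" "j"] l by simp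
  also have "p @ q @ j @ p @ k' @ q @ k' @ j \<approx> p @ q @ j @ p @ q @ k @ k' @ j"
    using cong[OF sym[OF k(1)], of "p @ q @ j @ p" "k' @ j"] l by simp
  also have "p @ q @ j @ p @ q @ k @ k' @ j \<approx> p @ q @ j @ p @ q @ k @ j @ k'"
    using cong[OF sym[OF jk(2)], of "p @ q @ j @ p @ q @ k" "[]"] l by simp
  also have "p @ q @ j @ p @ q @ k @ j @ k' \<approx> p @ q @ j @ p @ q @ j @ k @ k'"
    using cong[OF sym[OF jk(1)], of "p @ q @ j @ p @ q" "k'"] l by simp
  also have "p @ q @ j @ p @ q @ j @ k @ k' \<approx> p @ q @ p @ j' @ q @ j @ k @ k'"
    using cong[OF sym[OF j(2)], of "p @ q" "q @ j @ k @ k'"] l by simp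
  also have "p @ q @ p @ j' @ q @ j @ k @ k' \<approx> p @ q @ p @ q @ j' @ j @ k @ k'"
    using cong[OF sym[OF j(4)], of "p @ q @ p" "j @ k @ k'"] l by simp
  also have "p @ q @ p @ q @ j' @ j @ k @ k' \<approx> p @ q @ p @ q @ j @ j' @ k @ k'"
    using cong[OF sym[OF j(5)], of "p @ q @ p @ q" "k @ k'"] l by simp
  \<comment> \<open>All extra factors now stand on the right, so the relation between
    \<open>p\<close> and \<open>q\<close> applies. The remaining steps distribute them over the
    other side.\<close>
  also have "p @ q @ p @ q @ j @ j' @ k @ k' \<approx> q @ p @ q @ p @ j @ j' @ k @ k'"
    using cong[OF pq, of "[]" "j @ j' @ k @ k'"] l by simp
  also have "q @ p @ q @ p @ j @ j' @ k @ k' \<approx> q @ p @ q @ j' @ p @ j' @ k @ k'"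
    using cong[OF j(1), of "q @ p @ q" "j' @ k @ k'"] l by simp
  also have "q @ p @ q @ j' @ p @ j' @ k @ k' \<approx> q @ p @ q @ j' @ j @ p @ k @ k'"
    using cong[OF j(2), of "q @ p @ q @ j'" "k @ k'"] l by simp
  also have "q @ p @ q @ j' @ j @ p @ k @ k' \<approx> q @ p @ j' @ q @ j @ p @ k @ k'"
    using cong[OF j(4), of "q @ p" "j @ p @ k @ k'"] l by simp
  also have "q @ p @ j' @ q @ j @ p @ k @ k' \<approx> q @ j @ p @ q @ j @ p @ k @ k'"
    using cong[OF j(2), of "q" "q @ j @ p @ k @ k'"] l by simp
  also have "q @ j @ p @ q @ j @ p @ k @ k' \<approx> q @ j @ p @ q @ j @ p @ k' @ k"
    using cong[OF k(5), of "q @ j @ p @ q @ j @ p" "[]"] l by simp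
  also have "q @ j @ p @ q @ j @ p @ k' @ k \<approx> q @ j @ p @ q @ j @ k' @ p @ k"
    using cong[OF k(4), of "q @ j @ p @ q @ j" "k"] l by simp
  also have "q @ j @ p @ q @ j @ k' @ p @ k \<approx> q @ j @ p @ q @ k' @ j @ p @ k"
    using cong[OF jk(2), of "q @ j @ p @ q" "p @ k"] l by simp
  also have "q @ j @ p @ q @ k' @ j @ p @ k \<approx> q @ j @ p @ k @ q @ j @ p @ k"
    using cong[OF k(2), of "q @ j @ p" "j @ p @ k"] l by simp
  finally show ?thesis by simp
qed

section \<open>Homomorphisms from the Artin monoid of type B2\<close>

lemma B2_hom:
  assumes l: "u \<in> lists (nodes M)" "v \<in> lists (nodes M)" and uv: "u @ v @ u @ v \<approx> v @ u @ v @ u"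
  shows "\<exists>h\<in>monoid_hom (artin_monoid (type_B 2)) (artin_monoid M).
    h (artin_gen (type_B 2) 1) = artin_word M u \<and> h (artin_gen (type_B 2) 2) = artin_word M v"
proof
  define \<phi> where "\<phi> i = (if i = 1 then u else v)" for i :: int
  \<comment> \<open>All words of a class have the same image, so this union is that image and no
    representative has to be chosen.\<close>
  define h where "h X = (\<Union>w\<in>X. artin_word M (concat (map \<phi> w)))" for X
  let ?B = "type_B 2"
  have \<phi>l: "concat (map \<phi> w) \<in> lists (nodes M)" for w
    using l by (induction w) (auto simp: \<phi>_def)
  have rel: "(concat (map \<phi> a), concat (map \<phi> b)) \<in> word_cong (nodes M) (braid_relations M)"
    if ab: "(a, b) \<in> braid_relations ?B" for a b
  proof -
    obtain i j k where *: "a = alternating i j k" "b = alternating j i k" "i \<in> nodes ?B"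
      "j \<in> nodes ?B" "i \<noteq> j" "entry ?B i j = enat k"
      using ab by (auto simp: braid_relations_def)
    have ij: "i = 1 \<and> j = 2 \<or> i = 2 \<and> j = 1" using *(3-5) by (auto simp: type_B_def)
    then have "entry ?B i j = 4" by (auto simp: type_B_def insert_commute)
    then have "k = 4" using *(6) by (simp add: numeral_eq_enat)
    then show ?thesis using *(1,2) ij uv word_cong.sym[OF uv]
      by (auto simp: numeral_eq_Suc \<phi>_def)
  qed
  have h: "h (artin_word ?B w) = artin_word M (concat (map \<phi> w))" if w: "w \<in> lists (nodes ?B)" for w
  proof -
    have "artin_word M (concat (map \<phi> w')) = artin_word M (concat (map \<phi> w))"
      if "w' \<in> artin_word ?B w" for w'
    proof -
      have "(w, w') \<in> word_cong (nodes ?B) (braid_relations ?B)"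
        using that by (simp add: artin_word_def word_class_def)
      then have "concat (map \<phi> w) \<approx> concat (map \<phi> w')"
        by (rule word_cong_map) (use l rel in \<open>auto simp: \<phi>_def\<close>)
      then show ?thesis using artin_word_eq_iff[OF \<phi>l \<phi>l] by metis
    qed
    moreover have "w \<in> artin_word ?B w"
      using word_cong.refl[OF w] by (simp add: artin_word_def word_class_def)
    ultimately show ?thesis unfolding h_def by blast
  qed
  have car: "carrier (artin_monoid N) = artin_word N ` lists (nodes N)" for N :: "'b coxeter_matrix"
    by (simp add: artin_monoid_def artin_word_def carrier_presented_monoid)
  have mul: "artin_word N a \<otimes>\<^bsub>artin_monoid N\<^esub> artin_word N b = artin_word N (a @ b)"
    if "a \<in> lists (nodes N)" "b \<in> lists (nodes N)" for a b and N :: "'b coxeter_matrix"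
    using mult_word_class[OF that] by (simp add: artin_monoid_def artin_word_def)
  have one: "\<one>\<^bsub>artin_monoid N\<^esub> = artin_word N []" for N :: "'b coxeter_matrix"
    by (simp add: artin_monoid_def artin_word_def one_presented_monoid)
  show "h \<in> monoid_hom (artin_monoid ?B) (artin_monoid M)"
    unfolding monoid_hom_def hom_def
  proof (intro CollectI conjI funcsetI ballI)
    fix X assume "X \<in> carrier (artin_monoid ?B)"
    then obtain a where a: "X = artin_word ?B a" "a \<in> lists (nodes ?B)" unfolding car by blast
    then show "h X \<in> carrier (artin_monoid M)" using h[OF a(2)] \<phi>l unfolding car by blast
    fix Y assume "Y \<in> carrier (artin_monoid ?B)"
    then obtain b where b: "Y = artin_word ?B b" "b \<in> lists (nodes ?B)" unfolding car by blast
    have ab: "a @ b \<in> lists (nodes ?B)" using a(2) b(2) by simp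
    show "h (X \<otimes>\<^bsub>artin_monoid ?B\<^esub> Y) = h X \<otimes>\<^bsub>artin_monoid M\<^esub> h Y"
      unfolding a(1) b(1) mul[OF a(2) b(2)] h[OF ab] h[OF a(2)] h[OF b(2)] mul[OF \<phi>l \<phi>l] by simp
  next
    show "h \<one>\<^bsub>artin_monoid ?B\<^esub> = \<one>\<^bsub>artin_monoid M\<^esub>"
      using h[of "[]"] by (simp add: one)
  qed
  show "h (artin_gen ?B 1) = artin_word M u \<and> h (artin_gen ?B 2) = artin_word M v"
    using h[of "[1]"] h[of "[2]"] by (simp add: type_B_def \<phi>_def)
qed


text \<open>In type A the conjugation rules are proved with reversals, but the braid relation with
  folded words for the same sets; this lemma connects the two.\<close>

lemma conjugation_transfer:
  assumes "is_longest Q w" "is_longest Q w'" "w @ u \<approx> v @ w" "u \<in> lists (nodes M)"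
  shows "w' @ u \<approx> v @ w'"
proof -
  have "w \<approx> w'" by (rule is_longest_unique[OF assms(1,2)])
  moreover have "v \<in> lists (nodes M)" using word_cong_in_lists(2)[OF assms(3)] by simp
  ultimately show ?thesis
    using assms(3,4) by (meson word_cong.refl word_cong.sym word_cong.trans word_cong_append2)
qed

lemma conjugation_Un:
  assumes "orthogonal M K L" "is_longest K u" "is_longest L v"
    "\<forall>i\<in>K. u @ [i] \<approx> [\<sigma> i] @ u \<and> \<sigma> i \<in> K" "\<forall>i\<in>L. v @ [i] \<approx> [\<sigma> i] @ v \<and> \<sigma> i \<in> L"
    "i \<in> K \<union> L"
  shows "(u @ v) @ [i] \<approx> [\<sigma> i] @ (u @ v)"
proof -
  note l = is_longest_lists[OF assms(2)] is_longest_lists[OF assms(3)]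
  note comm = orthogonal_commute[OF assms(1) l(3,6)]
  note [trans] = word_cong.trans
  show ?thesis
  proof (cases "i \<in> K")
    case True
    then have i: "[i] \<in> lists K" "[i] \<in> lists (nodes M)" using l(3) by auto
    have "u @ (v @ [i]) \<approx> u @ ([i] @ v)"
      using word_cong_append2[OF word_cong.refl[OF l(2)] word_cong.sym[OF comm[OF i(1) l(4)]]] .
    also have "u @ ([i] @ v) \<approx> [\<sigma> i] @ (u @ v)"
      using word_cong_append2[OF _ word_cong.refl[OF l(5)], of "u @ [i]" "[\<sigma> i] @ u"] assms(4) True by simp
    finally show ?thesis by simp
  next
    case False
    then have i: "i \<in> L" "[\<sigma> i] \<in> lists L" using assms(5,6) by auto
    have "u @ (v @ [i]) \<approx> u @ ([\<sigma> i] @ v)"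
      using word_cong_append2[OF word_cong.refl[OF l(2)], of "v @ [i]" "[\<sigma> i] @ v"] assms(5) i by blast
    also have "u @ ([\<sigma> i] @ v) \<approx> [\<sigma> i] @ (u @ v)"
      using word_cong_append2[OF comm[OF l(1) i(2)] word_cong.refl[OF l(5)]] by simp
    finally show ?thesis by simp
  qed
qed

text \<open>Conjugation by \<open>p\<close> and \<open>q\<close> acts on nodes by
  \<open>\<sigma>\<close> and \<open>\<tau>\<close>. The hypotheses on \<open>J\<close> and
  \<open>K\<close> are those of \<open>braid_relation_enlarge\<close>, with \<open>j'\<close> and
  \<open>k'\<close> the longest words of the images of \<open>J\<close> and \<open>K\<close>. The
  word \<open>w\<close> ensures that all subsets of the nodes have longest words.\<close>

lemma B2_hom_longest:
  assumes p: "is_longest P p" and q: "is_longest Q q" and pq: "p @ q @ p @ q \<approx> q @ p @ q @ p"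
    and w: "is_longest (nodes M) w"
    and \<sigma>: "\<forall>i\<in>P. p @ [i] \<approx> [\<sigma> i] @ p" "\<forall>i\<in>P. \<forall>j\<in>P. c (\<sigma> i) (\<sigma> j) = c i j"
    and \<tau>: "\<forall>i\<in>Q. q @ [i] \<approx> [\<tau> i] @ q" "\<forall>i\<in>Q. \<forall>j\<in>Q. c (\<tau> i) (\<tau> j) = c i j"
    and J: "J \<subseteq> P" "\<sigma> ` J \<subseteq> P" "\<sigma> ` \<sigma> ` J = J" "orthogonal M J Q"
      "\<sigma> ` J \<subseteq> Q" "\<tau> ` \<sigma> ` J = \<sigma> ` J"
    and K: "K \<subseteq> Q" "\<tau> ` K \<subseteq> Q" "\<tau> ` \<tau> ` K = K" "orthogonal M K P" "orthogonal M (\<tau> ` K) P"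
      "weakly_orthogonal M K (\<tau> ` K)"
  shows "\<exists>h\<in>monoid_hom (artin_monoid (type_B 2)) (artin_monoid M).
    h (artin_gen (type_B 2) 1) = T_longest M (P \<union> K) \<and>
    h (artin_gen (type_B 2) 2) = T_longest M (Q \<union> J)"
proof -
  note lp = is_longest_lists[OF p] and lq = is_longest_lists[OF q]
  obtain j where j: "is_longest J j" using is_longest_subset[OF w, of J] J(1) lp(3) by blast
  obtain j' where j': "is_longest (\<sigma> ` J) j'" using is_longest_subset[OF w, of "\<sigma> ` J"] J(2) lp(3) by blast
  obtain k where k: "is_longest K k" using is_longest_subset[OF w, of K] K(1) lq(3) by blast
  obtain k' where k': "is_longest (\<tau> ` K) k'" using is_longest_subset[OF w, of "\<tau> ` K"] K(2) lq(3) by blast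
  note lj = is_longest_lists[OF j] and lj' = is_longest_lists[OF j']
    and lk = is_longest_lists[OF k] and lk' = is_longest_lists[OF k']
  have Pk: "is_longest (P \<union> K) (p @ k)"
    using is_longest_Un[OF orthogonal_sym[OF K(4) lk(3) lp(3)] p k] .
  have Qj: "is_longest (Q \<union> J) (q @ j)"
    using is_longest_Un[OF orthogonal_sym[OF J(4) lj(3) lq(3)] q j] .
  have mem: "k \<in> lists Q" "k' \<in> lists Q" "j' \<in> lists Q" using lk(1) lk'(1) lj'(1) K(1,2) J(5) by auto
  have "(p @ k) @ (q @ j) @ (p @ k) @ (q @ j) \<approx> (q @ j) @ (p @ k) @ (q @ j) @ (p @ k)"
  proof (rule braid_relation_enlarge)
    show "p @ q @ p @ q \<approx> q @ p @ q @ p" by fact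
    show "p @ j \<approx> j' @ p"
      by (rule conjugate_longest[OF p _ j j']) (use \<sigma> J(1) in auto)
    show "p @ j' \<approx> j @ p"
      by (rule conjugate_longest[OF p _ j', of \<sigma>]) (use \<sigma> J(2,3) j in \<open>auto simp: subset_eq\<close>)
    show "q @ k \<approx> k' @ q"
      by (rule conjugate_longest[OF q _ k k']) (use \<tau> K(1) in auto)
    show "q @ k' \<approx> k @ q"
      by (rule conjugate_longest[OF q _ k', of \<tau>]) (use \<tau> K(2,3) k in \<open>auto simp: subset_eq\<close>)
    show "q @ j' \<approx> j' @ q"
      by (rule conjugate_longest[OF q _ j', of \<tau>]) (use \<tau> J(5,6) j' in \<open>auto simp: subset_eq\<close>)
    show "q @ j \<approx> j @ q"
      by (rule word_cong.sym[OF orthogonal_commute[OF J(4) lj(3) lq(3) lj(1) lq(1)]])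
    show "j @ j' \<approx> j' @ j" "j @ k \<approx> k @ j" "j @ k' \<approx> k' @ j"
      using orthogonal_commute[OF J(4) lj(3) lq(3) lj(1)] mem by blast+
    show "p @ k \<approx> k @ p"
      by (rule word_cong.sym[OF orthogonal_commute[OF K(4) lk(3) lp(3) lk(1) lp(1)]])
    show "p @ k' \<approx> k' @ p"
      by (rule word_cong.sym[OF orthogonal_commute[OF K(5) lk'(3) lp(3) lk'(1) lp(1)]])
    show "k @ k' \<approx> k' @ k" by (rule weakly_orthogonal_commute[OF K(6) k k'])
  qed fact+
  from B2_hom[OF _ _ this] show ?thesis
    using T_longest_eq[OF Pk] T_longest_eq[OF Qj] is_longest_lists(2)[OF Pk] is_longest_lists(2)[OF Qj]
    by simp
qed

end

section \<open>Words acting on sequences\<close>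

fun move_right :: "int \<Rightarrow> nat \<Rightarrow> int list" where
  "move_right a 0 = []"
| "move_right a (Suc k) = move_right a k @ [a + int k]"

fun move_left :: "int \<Rightarrow> nat \<Rightarrow> int list" where
  "move_left a 0 = []"
| "move_left a (Suc k) = (a + int k) # move_left a k"

text \<open>The first entry goes to the last place, then the entries in front of it are reversed: a
  reduced word of the longest permutation.\<close>

fun reversal :: "int \<Rightarrow> nat \<Rightarrow> int list" where
  "reversal a 0 = []"
| "reversal a (Suc k) = move_right a k @ reversal a k"

text \<open>The entries of the first block, last one first, are moved past the whole second
  block.\<close>

fun block_swap :: "int \<Rightarrow> nat \<Rightarrow> nat \<Rightarrow> int list" where
  "block_swap a 0 t = []"
| "block_swap a (Suc s) t = move_right (a + int s) t @ block_swap a s t"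

lemma set_move_right: "set (move_right a k) = {a..a + int k - 1}"
  by (induction k) auto

lemma set_move_left: "set (move_left a k) = {a..a + int k - 1}"
  by (induction k) auto

lemma set_reversal: "set (reversal a k) \<subseteq> {a..a + int k - 2}"
  by (induction k) (auto simp: set_move_right)

lemma set_block_swap: "set (block_swap a s t) \<subseteq> {a..a + int s + int t - 2}"
  by (induction s) (auto simp: set_move_right)

definition reverse_at :: "int \<Rightarrow> nat \<Rightarrow> (int \<Rightarrow> int) \<Rightarrow> int \<Rightarrow> int" where
  "reverse_at a k x = (\<lambda>i. if a \<le> i \<and> i < a + int k then x (2 * a + int k - 1 - i) else x i)"

definition swap_at :: "int \<Rightarrow> nat \<Rightarrow> nat \<Rightarrow> (int \<Rightarrow> int) \<Rightarrow> int \<Rightarrow> int" where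
  "swap_at a s t x = (\<lambda>i. if a \<le> i \<and> i < a + int t then x (i + int s)
     else if a + int t \<le> i \<and> i < a + int t + int s then x (i - int t) else x i)"

text \<open>A sequence \<open>x\<close> is encoded by the position \<open>P x\<close> of the numbers game, and the word \<open>g i\<close>
  exchanges \<open>x i\<close> and \<open>x (i + 1)\<close>. The words \<open>g i\<close> are longer than one letter when the
  diagram of \<open>M\<close> is folded.\<close>

locale chain = cartan_datum M c for M :: "int coxeter_matrix" and c +
  fixes P :: "(int \<Rightarrow> int) \<Rightarrow> int \<Rightarrow> int" and g :: "int \<Rightarrow> int list" and N r :: int
  assumes g_nodes: "\<lbrakk>1 \<le> i; i < N\<rbrakk> \<Longrightarrow> g i \<in> lists (nodes M)"
    and g_play: "\<lbrakk>1 \<le> i; i < N\<rbrakk> \<Longrightarrow> play c (P x) (g i) = P (x \<circ> transpose i (i + 1))"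
    and g_legal: "\<lbrakk>1 \<le> i; i < N; x (i + 1) < x i\<rbrakk> \<Longrightarrow> legal c (P x) (g i)"
    and g_terminal: "\<lbrakk>1 \<le> i; i < N; x i \<le> x (i + 1); j \<in> set (g i)\<rbrakk> \<Longrightarrow> P x j \<le> 0"
    and start: "j \<in> nodes M \<Longrightarrow> 0 < P (\<lambda>i. r - i) j"
begin

abbreviation gw :: "int list \<Rightarrow> int list" where
  "gw u \<equiv> concat (map g u)"

abbreviation support :: "int set \<Rightarrow> int set" where
  "support S \<equiv> \<Union>i\<in>S. set (g i)"

lemma gw_support: "set u \<subseteq> S \<Longrightarrow> gw u \<in> lists (support S)"
  by (induction u) auto

lemma gw_nodes: "set u \<subseteq> {1..N - 1} \<Longrightarrow> gw u \<in> lists (nodes M)"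
  using g_nodes by (induction u) fastforce+

text \<open>Effect and legality share one induction, since legality of the last letter depends on
  the sequence reached before it. The following lemmas have the same pattern.\<close>

lemma gw_move_right:
  assumes "1 \<le> a" "a + int k \<le> N"
  shows "play c (P x) (gw (move_right a k)) = P (\<lambda>i. if a \<le> i \<and> i < a + int k then x (i + 1)
           else if i = a + int k then x a else x i)" (is "_ = P (?f k)")
    and "(\<And>j. a < j \<Longrightarrow> j \<le> a + int k \<Longrightarrow> x j < x a) \<Longrightarrow> legal c (P x) (gw (move_right a k))"
proof -
  have "play c (P x) (gw (move_right a k)) = P (?f k) \<and>
    ((\<forall>j. a < j \<and> j \<le> a + int k \<longrightarrow> x j < x a) \<longrightarrow> legal c (P x) (gw (move_right a k)))"
    using assms(2)
  proof (induction k)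
    case 0
    have "?f 0 = x" by (auto simp: fun_eq_iff)
    then show ?case by simp
  next
    case (Suc k)
    have "?f k \<circ> transpose (a + int k) (a + int k + 1) = ?f (Suc k)"
      by (auto simp: fun_eq_iff transpose_def)
    then have "play c (P x) (gw (move_right a (Suc k))) = P (?f (Suc k))"
      using Suc g_play[of "a + int k" "?f k"] assms(1) by (simp add: algebra_simps)
    then show ?case using Suc g_legal[of "a + int k" "?f k"] assms(1) by simp
  qed
  then show "play c (P x) (gw (move_right a k)) = P (?f k)"
    "(\<And>j. a < j \<Longrightarrow> j \<le> a + int k \<Longrightarrow> x j < x a) \<Longrightarrow> legal c (P x) (gw (move_right a k))"
    by blast+
qed

lemma gw_move_left:
  assumes "1 \<le> a" "a + int k \<le> N"
  shows "play c (P x) (gw (move_left a k)) = P (\<lambda>i. if i = a then x (a + int k)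
           else if a < i \<and> i \<le> a + int k then x (i - 1) else x i)" (is "_ = P (?f k x)")
    and "(\<And>j. a \<le> j \<Longrightarrow> j < a + int k \<Longrightarrow> x (a + int k) < x j) \<Longrightarrow> legal c (P x) (gw (move_left a k))"
proof -
  have "play c (P x) (gw (move_left a k)) = P (?f k x) \<and>
    ((\<forall>j. a \<le> j \<and> j < a + int k \<longrightarrow> x (a + int k) < x j) \<longrightarrow> legal c (P x) (gw (move_left a k)))"
    using assms(2)
  proof (induction k arbitrary: x)
    case 0
    have "?f 0 x = x" by (auto simp: fun_eq_iff)
    then show ?case by simp
  next
    case (Suc k)
    define x' where "x' = x \<circ> transpose (a + int k) (a + int k + 1)"
    have x': "play c (P x) (g (a + int k)) = P x'"
      using g_play[of "a + int k" x] Suc.prems assms(1) by (simp add: x'_def)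
    have IH: "play c (P x') (gw (move_left a k)) = P (?f k x')"
      "(\<forall>j. a \<le> j \<and> j < a + int k \<longrightarrow> x' (a + int k) < x' j) \<longrightarrow> legal c (P x') (gw (move_left a k))"
      using Suc.IH[of x'] Suc.prems by simp_all
    have "?f k x' = ?f (Suc k) x"
      by (auto simp: fun_eq_iff transpose_def x'_def algebra_simps intro!: arg_cong[of _ _ x])
    then have "play c (P x) (gw (move_left a (Suc k))) = P (?f (Suc k) x)"
      using IH(1) x' by simp
    moreover have "legal c (P x) (gw (move_left a (Suc k)))"
      if *: "\<forall>j. a \<le> j \<and> j < a + int (Suc k) \<longrightarrow> x (a + int (Suc k)) < x j"
    proof -
      have "legal c (P x') (gw (move_left a k))"
        by (rule mp[OF IH(2)]) (use * in \<open>auto simp: x'_def transpose_def algebra_simps\<close>)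
      moreover have "x (a + int k + 1) < x (a + int k)"
        using *[rule_format, of "a + int k"] by (simp add: algebra_simps)
      ultimately show ?thesis using g_legal[of "a + int k" x] x' assms(1) Suc.prems by simp
    qed
    ultimately show ?case by blast
  qed
  then show "play c (P x) (gw (move_left a k)) = P (?f k x)"
    "(\<And>j. a \<le> j \<Longrightarrow> j < a + int k \<Longrightarrow> x (a + int k) < x j) \<Longrightarrow> legal c (P x) (gw (move_left a k))"
    by blast+
qed

lemma gw_reversal:
  assumes "1 \<le> a" "a + int k \<le> N + 1"
  shows "play c (P x) (gw (reversal a k)) = P (reverse_at a k x)"
    and "(\<And>i j. a \<le> i \<Longrightarrow> i < j \<Longrightarrow> j < a + int k \<Longrightarrow> x j < x i) \<Longrightarrow> legal c (P x) (gw (reversal a k))"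
proof -
  have "play c (P x) (gw (reversal a k)) = P (reverse_at a k x) \<and>
    ((\<forall>i j. a \<le> i \<and> i < j \<and> j < a + int k \<longrightarrow> x j < x i) \<longrightarrow> legal c (P x) (gw (reversal a k)))"
    using assms(2)
  proof (induction k arbitrary: x)
    case 0
    have "reverse_at a 0 x = x" by (auto simp: fun_eq_iff reverse_at_def)
    then show ?case by simp
  next
    case (Suc k)
    define x' where "x' = (\<lambda>i. if a \<le> i \<and> i < a + int k then x (i + 1)
             else if i = a + int k then x a else x i)"
    have ak: "a + int k \<le> N" using Suc.prems by simp
    note m = gw_move_right[OF assms(1) ak, of x, folded x'_def]
    have IH: "play c (P x') (gw (reversal a k)) = P (reverse_at a k x')"
      "(\<forall>i j. a \<le> i \<and> i < j \<and> j < a + int k \<longrightarrow> x' j < x' i) \<longrightarrow> legal c (P x') (gw (reversal a k))"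
      using Suc.IH[of x'] Suc.prems by simp_all
    have "reverse_at a k x' = reverse_at a (Suc k) x"
      by (auto simp: fun_eq_iff reverse_at_def x'_def algebra_simps)
    then have "play c (P x) (gw (reversal a (Suc k))) = P (reverse_at a (Suc k) x)"
      using m(1) IH(1) by simp
    moreover have "legal c (P x) (gw (reversal a (Suc k)))"
      if *: "\<forall>i j. a \<le> i \<and> i < j \<and> j < a + int (Suc k) \<longrightarrow> x j < x i"
    proof -
      have "legal c (P x') (gw (reversal a k))"
        by (rule mp[OF IH(2)]) (use * in \<open>auto simp: x'_def\<close>)
      moreover have "legal c (P x) (gw (move_right a k))"
        by (rule m(2)) (use * in auto)
      ultimately show ?thesis using m(1) by simp
    qed
    ultimately show ?case by blast
  qed
  then show "play c (P x) (gw (reversal a k)) = P (reverse_at a k x)"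
    "(\<And>i j. a \<le> i \<Longrightarrow> i < j \<Longrightarrow> j < a + int k \<Longrightarrow> x j < x i) \<Longrightarrow> legal c (P x) (gw (reversal a k))"
    by blast+
qed

lemma gw_block_swap:
  assumes "1 \<le> a" "a + int s + int t \<le> N + 1"
  shows "play c (P x) (gw (block_swap a s t)) = P (swap_at a s t x)"
    and "(\<And>i j. a \<le> i \<Longrightarrow> i < a + int s \<Longrightarrow> a + int s \<le> j \<Longrightarrow> j < a + int s + int t \<Longrightarrow> x j < x i)
      \<Longrightarrow> legal c (P x) (gw (block_swap a s t))"
proof -
  have "play c (P x) (gw (block_swap a s t)) = P (swap_at a s t x) \<and>
    ((\<forall>i j. a \<le> i \<and> i < a + int s \<and> a + int s \<le> j \<and> j < a + int s + int t \<longrightarrow> x j < x i)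
      \<longrightarrow> legal c (P x) (gw (block_swap a s t)))"
    using assms(2)
  proof (induction s arbitrary: x)
    case 0
    have "swap_at a 0 t x = x" by (auto simp: fun_eq_iff swap_at_def)
    then show ?case by simp
  next
    case (Suc s)
    define x' where "x' = (\<lambda>i. if a + int s \<le> i \<and> i < a + int s + int t then x (i + 1)
             else if i = a + int s + int t then x (a + int s) else x i)"
    have as: "1 \<le> a + int s" "a + int s + int t \<le> N" using Suc.prems assms(1) by simp_all
    note m = gw_move_right[OF as, of x, folded x'_def]
    have IH: "play c (P x') (gw (block_swap a s t)) = P (swap_at a s t x')"
      "(\<forall>i j. a \<le> i \<and> i < a + int s \<and> a + int s \<le> j \<and> j < a + int s + int t \<longrightarrow> x' j < x' i)
        \<longrightarrow> legal c (P x') (gw (block_swap a s t))"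
      using Suc.IH[of x'] Suc.prems by simp_all
    have "swap_at a s t x' = swap_at a (Suc s) t x"
      by (auto simp: fun_eq_iff swap_at_def x'_def algebra_simps intro!: arg_cong[of _ _ x])
    then have "play c (P x) (gw (block_swap a (Suc s) t)) = P (swap_at a (Suc s) t x)"
      using m(1) IH(1) by simp
    moreover have "legal c (P x) (gw (block_swap a (Suc s) t))"
      if *: "\<forall>i j. a \<le> i \<and> i < a + int (Suc s) \<and> a + int (Suc s) \<le> j \<and> j < a + int (Suc s) + int t
        \<longrightarrow> x j < x i"
    proof -
      have "legal c (P x') (gw (block_swap a s t))"
        by (rule mp[OF IH(2)]) (use * in \<open>auto simp: x'_def\<close>)
      moreover have "legal c (P x) (gw (move_right (a + int s) t))"
        by (rule m(2)) (use * in auto)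
      ultimately show ?thesis using m(1) by simp
    qed
    ultimately show ?case by blast
  qed
  then show "play c (P x) (gw (block_swap a s t)) = P (swap_at a s t x)"
    "(\<And>i j. a \<le> i \<Longrightarrow> i < a + int s \<Longrightarrow> a + int s \<le> j \<Longrightarrow> j < a + int s + int t \<Longrightarrow> x j < x i)
      \<Longrightarrow> legal c (P x) (gw (block_swap a s t))"
    by blast+
qed

text \<open>The play starts from a decreasing sequence and leaves the block increasing, where
  \<open>g_terminal\<close> applies.\<close>

lemma is_longest_reversal:
  assumes "1 \<le> a" "a + int k \<le> N + 1"
  shows "is_longest (support {a..a + int k - 2}) (gw (reversal a k))"
proof (rule is_longestI)
  show "support {a..a + int k - 2} \<subseteq> nodes M"
  proof safe
    fix i j assume "i \<in> {a..a + int k - 2}" "j \<in> set (g i)"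
    then show "j \<in> nodes M" using g_nodes[of i] assms by auto
  qed
  show "\<forall>i\<in>nodes M. 0 < P (\<lambda>i. r - i) i" using start by blast
  show "gw (reversal a k) \<in> lists (support {a..a + int k - 2})"
    by (rule gw_support[OF set_reversal])
  show "legal c (P (\<lambda>i. r - i)) (gw (reversal a k))"
    using gw_reversal(2)[OF assms] by simp
  show "\<forall>j\<in>support {a..a + int k - 2}. play c (P (\<lambda>i. r - i)) (gw (reversal a k)) j \<le> 0"
    unfolding gw_reversal(1)[OF assms]
  proof safe
    fix i j assume i: "i \<in> {a..a + int k - 2}" "j \<in> set (g i)"
    show "P (reverse_at a k (\<lambda>i. r - i)) j \<le> 0"
      by (rule g_terminal[OF _ _ _ i(2)]) (use i(1) assms in \<open>auto simp: reverse_at_def\<close>)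
  qed
qed

text \<open>Reversal takes the neighbours \<open>i\<close>, \<open>i + 1\<close> to their mirror
  image in the block. Equal lengths are demanded by \<open>conjugate_word\<close>, and in folded
  diagrams the words \<open>g i\<close> can differ in length.\<close>

lemma reversal_conjugate:
  assumes "1 \<le> a" "a + int k \<le> N + 1" "a \<le> i" "i \<le> a + int k - 2"
    "length (g i) = length (g (2 * a + int k - 2 - i))"
  shows "gw (reversal a k) @ g i \<approx> g (2 * a + int k - 2 - i) @ gw (reversal a k)"
proof (rule conjugate_word)
  let ?x = "\<lambda>i. r - i" and ?i = "2 * a + int k - 2 - i" and ?t = "\<lambda>i. transpose i (i + 1)"
  have i: "1 \<le> i" "i < N" "1 \<le> ?i" "?i < N" using assms by auto
  note p = gw_reversal(1)[OF assms(1,2)] g_play[OF i(1,2)] g_play[OF i(3,4)]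
  show "\<forall>i\<in>nodes M. 0 < P ?x i" using start by blast
  show "gw (reversal a k) \<in> lists (nodes M)"
    by (rule gw_nodes) (use set_reversal[of a k] assms in auto)
  show "legal c (P ?x) (gw (reversal a k))" using gw_reversal(2)[OF assms(1,2)] by simp
  show "g i \<in> lists (nodes M)" "g ?i \<in> lists (nodes M)" using g_nodes i by blast+
  show "length (g i) = length (g ?i)" by fact
  have "reverse_at a k (?x \<circ> ?t ?i) = reverse_at a k ?x \<circ> ?t i"
    using assms(3,4) by (auto simp: fun_eq_iff reverse_at_def transpose_def)
  then show "play c (P ?x) (g ?i @ gw (reversal a k)) = play c (P ?x) (gw (reversal a k) @ g i)"
    by (simp add: p)
  have "(reverse_at a k ?x \<circ> ?t i) \<circ> ?t i = reverse_at a k ?x"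
    by (simp add: fun_eq_iff)
  then show "play c (P ?x) (gw (reversal a k) @ g i @ g i) = play c (P ?x) (gw (reversal a k))"
    by (simp add: p)
  have "(reverse_at a k ?x \<circ> ?t i) (i + 1) < (reverse_at a k ?x \<circ> ?t i) i"
    using assms(3,4) by (auto simp: reverse_at_def)
  then show "legal c (play c (P ?x) (gw (reversal a k) @ g i)) (g i)"
    using g_legal[OF i(1,2)] by (simp add: p)
qed

end

section \<open>Sign changes\<close>

text \<open>Each sign change in the block also flips the entry at \<open>n + 1\<close>, as type D
  requires; after \<open>k\<close> of them the factor \<open>(-1) ^ k\<close> is left there.\<close>

definition negate_at :: "int \<Rightarrow> int \<Rightarrow> nat \<Rightarrow> (int \<Rightarrow> int) \<Rightarrow> int \<Rightarrow> int" where
  "negate_at n a k x = (\<lambda>i. if a \<le> i \<and> i < a + int k then - x i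
     else if i = n + 1 then (-1) ^ k * x i else x i)"

text \<open>The entry at \<open>p\<close> is carried to place \<open>n\<close>, flipped there, and
  carried back.\<close>

definition negation_step :: "int \<Rightarrow> int \<Rightarrow> int list" where
  "negation_step n p = move_right p (nat (n - p)) @ [n] @ move_left p (nat (n - p))"

fun negation :: "int \<Rightarrow> int \<Rightarrow> nat \<Rightarrow> int list" where
  "negation n a 0 = []"
| "negation n a (Suc k) = negation_step n a @ negation n (a + 1) k"

lemma negation_add: "negation n a (k + l) = negation n a k @ negation n (a + int k) l"
  by (induction k arbitrary: a) (simp_all add: algebra_simps)

lemma set_negation: "a + int k \<le> n + 1 \<Longrightarrow> set (negation n a k) \<subseteq> {a..n}"
proof (induction k arbitrary: a)
  case (Suc k)
  then have "set (negation n (a + 1) k) \<subseteq> {a + 1..n}" by simp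
  moreover have "set (negation_step n a) \<subseteq> {a..n}"
    using Suc.prems by (auto simp: negation_step_def set_move_right set_move_left)
  moreover have "{a + 1..n} \<subseteq> {a..n}" by auto
  ultimately show ?case by fastforce
qed simp

text \<open>In types A, B and D the word \<open>g n\<close> changes the sign of \<open>x n\<close>. The extra entry \<open>x (n + 1)\<close> is
  only relevant in type D, where sign changes come in pairs.\<close>

locale signed_chain = chain M c P g n "n + 1" for M c P g n +
  assumes n_pos: "1 \<le> n"
    and gn_play: "play c (P x) (g n) = P (x(n := - x n, n + 1 := - x (n + 1)))"
    and gn_legal: "\<bar>x (n + 1)\<bar> < x n \<Longrightarrow> legal c (P x) (g n)"
    and gn_terminal: "\<lbrakk>x n \<le> - \<bar>x (n + 1)\<bar>; j \<in> set (g n)\<rbrakk> \<Longrightarrow> P x j \<le> 0"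
    and nodes_eq: "nodes M = (\<Union>i\<in>{1..n}. set (g i))"
begin

lemma gw_nodes': "set u \<subseteq> {1..n} \<Longrightarrow> gw u \<in> lists (nodes M)"
  unfolding nodes_eq by (rule gw_support)

text \<open>On the way to place \<open>n\<close> the entry \<open>x p\<close> has to exceed those it
  passes, and on the way back \<open>- x p\<close> has to lie below them; hence the bound on
  absolute values.\<close>

lemma gw_negation_step:
  assumes "1 \<le> p" "p \<le> n"
  shows "play c (P x) (gw (negation_step n p)) = P (x(p := - x p, n + 1 := - x (n + 1)))"
    and "(\<And>q. p < q \<Longrightarrow> q \<le> n + 1 \<Longrightarrow> \<bar>x q\<bar> < x p) \<Longrightarrow> legal c (P x) (gw (negation_step n p))"
proof -
  define k where "k = nat (n - p)"
  have k: "p + int k \<le> n" "n = p + int k" using assms by (auto simp: k_def)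
  define y where "y = (\<lambda>i. if p \<le> i \<and> i < p + int k then x (i + 1)
           else if i = p + int k then x p else x i)"
  define z where "z = y(n := - y n, n + 1 := - y (n + 1))"
  have y: "play c (P x) (gw (move_right p k)) = P y"
    using gw_move_right(1)[OF assms(1) k(1), of x] by (simp add: y_def)
  have z: "play c (P y) (g n) = P z" using gn_play[of y] by (simp add: z_def)
  have zx: "(\<lambda>i. if i = p then z (p + int k) else if p < i \<and> i \<le> p + int k then z (i - 1) else z i)
      = x(p := - x p, n + 1 := - x (n + 1))"
    using k(2) by (auto simp: fun_eq_iff z_def y_def)
  show "play c (P x) (gw (negation_step n p)) = P (x(p := - x p, n + 1 := - x (n + 1)))"
    using y z gw_move_left(1)[OF assms(1) k(1), of z] unfolding zx
    by (simp add: negation_step_def flip: k_def)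
  assume *: "\<And>q. p < q \<Longrightarrow> q \<le> n + 1 \<Longrightarrow> \<bar>x q\<bar> < x p"
  have "x j < x p" if "p < j" "j \<le> p + int k" for j using *[of j] that k(2) by auto
  then have "legal c (P x) (gw (move_right p k))"
    by (rule gw_move_right(2)[OF assms(1) k(1)])
  moreover have "legal c (P y) (g n)"
    by (rule gn_legal) (use *[of "n + 1"] k(2) in \<open>auto simp: y_def\<close>)
  moreover have "z (p + int k) < z j" if "p \<le> j" "j < p + int k" for j
    using *[of "j + 1"] that k(2) by (auto simp: z_def y_def)
  then have "legal c (P z) (gw (move_left p k))"
    by (rule gw_move_left(2)[OF assms(1) k(1)])
  ultimately show "legal c (P x) (gw (negation_step n p))"
    using y z by (simp add: negation_step_def flip: k_def)
qed

lemma gw_negation: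
  assumes "1 \<le> a" "a + int k \<le> n + 1"
  shows "play c (P x) (gw (negation n a k)) = P (negate_at n a k x)"
    and "(\<And>p q. a \<le> p \<Longrightarrow> p < a + int k \<Longrightarrow> p < q \<Longrightarrow> q \<le> n + 1 \<Longrightarrow> \<bar>x q\<bar> < x p)
      \<Longrightarrow> legal c (P x) (gw (negation n a k))"
proof -
  have "play c (P x) (gw (negation n a k)) = P (negate_at n a k x) \<and>
    ((\<forall>p q. a \<le> p \<and> p < a + int k \<and> p < q \<and> q \<le> n + 1 \<longrightarrow> \<bar>x q\<bar> < x p)
      \<longrightarrow> legal c (P x) (gw (negation n a k)))"
    using assms
  proof (induction k arbitrary: a x)
    case 0
    have "negate_at n a 0 x = x" by (auto simp: fun_eq_iff negate_at_def)
    then show ?case by simp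
  next
    case (Suc k)
    define x' where "x' = x(a := - x a, n + 1 := - x (n + 1))"
    have a: "1 \<le> a" "a \<le> n" "1 \<le> a + 1" "a + 1 + int k \<le> n + 1" using Suc.prems by simp_all
    note m = gw_negation_step[OF a(1,2), of x, folded x'_def]
    have IH: "play c (P x') (gw (negation n (a + 1) k)) = P (negate_at n (a + 1) k x')"
      "(\<forall>p q. a + 1 \<le> p \<and> p < a + 1 + int k \<and> p < q \<and> q \<le> n + 1 \<longrightarrow> \<bar>x' q\<bar> < x' p)
        \<longrightarrow> legal c (P x') (gw (negation n (a + 1) k))"
      using Suc.IH[OF a(3,4), of x'] by simp_all
    have "negate_at n (a + 1) k x' = negate_at n a (Suc k) x"
      using a by (auto simp: fun_eq_iff negate_at_def x'_def)
    then have "play c (P x) (gw (negation n a (Suc k))) = P (negate_at n a (Suc k) x)"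
      using m(1) IH(1) by simp
    moreover have "legal c (P x) (gw (negation n a (Suc k)))"
      if *: "\<forall>p q. a \<le> p \<and> p < a + int (Suc k) \<and> p < q \<and> q \<le> n + 1 \<longrightarrow> \<bar>x q\<bar> < x p"
    proof -
      have "legal c (P x') (gw (negation n (a + 1) k))"
        by (rule mp[OF IH(2)]) (use * a in \<open>auto simp: x'_def\<close>)
      moreover have "legal c (P x) (gw (negation_step n a))"
        by (rule m(2)) (use * in auto)
      ultimately show ?thesis using m(1) by simp
    qed
    ultimately show ?case by blast
  qed
  then show "play c (P x) (gw (negation n a k)) = P (negate_at n a k x)"
    "(\<And>p q. a \<le> p \<Longrightarrow> p < a + int k \<Longrightarrow> p < q \<Longrightarrow> q \<le> n + 1 \<Longrightarrow> \<bar>x q\<bar> < x p)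
      \<Longrightarrow> legal c (P x) (gw (negation n a k))"
    by blast+
qed

lemma is_longest_negation:
  assumes "1 \<le> a" "a + int k = n + 1"
  shows "is_longest (support {a..n}) (gw (negation n a k))"
proof (rule is_longestI)
  \<comment> \<open>The entries at \<open>1..n\<close> are positive and decreasing and the one at
    \<open>n + 1\<close> is \<open>0\<close>, so the bounds on absolute values hold and flipping the
    extra entry has no effect.\<close>
  let ?x = "\<lambda>i. n + 1 - i"
  have k: "a + int k \<le> n + 1" using assms by simp
  show "support {a..n} \<subseteq> nodes M"
    unfolding nodes_eq by (rule UN_mono) (use assms in auto)
  show "\<forall>i\<in>nodes M. 0 < P ?x i" using start by blast
  show "gw (negation n a k) \<in> lists (support {a..n})"
    by (rule gw_support[OF set_negation[OF k]])
  show "legal c (P ?x) (gw (negation n a k))"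
    using gw_negation(2)[OF assms(1) k] by simp
  show "\<forall>j\<in>support {a..n}. play c (P ?x) (gw (negation n a k)) j \<le> 0"
  proof
    fix j assume "j \<in> support {a..n}"
    then obtain i where i: "a \<le> i" "i \<le> n" "j \<in> set (g i)" by auto
    show "play c (P ?x) (gw (negation n a k)) j \<le> 0"
      unfolding gw_negation(1)[OF assms(1) k]
    proof (cases "i = n")
      case True
      then show "P (negate_at n a k ?x) j \<le> 0"
        using gn_terminal[of "negate_at n a k ?x" j] i assms by (simp add: negate_at_def)
    next
      case False
      then show "P (negate_at n a k ?x) j \<le> 0"
        using g_terminal[of i "negate_at n a k ?x" j] i assms by (simp add: negate_at_def)
    qed
  qed
qed

text \<open>This reduces an identity in the Artin monoid to a computation with signed permutations
  and two checks of legality.\<close>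

lemma word_eqI:
  assumes "set u \<subseteq> {1..n}" "set v \<subseteq> {1..n}"
    "legal c (P (\<lambda>i. n + 1 - i)) (gw u)" "legal c (P (\<lambda>i. n + 1 - i)) (gw v)"
    "play c (P (\<lambda>i. n + 1 - i)) (gw u) = play c (P (\<lambda>i. n + 1 - i)) (gw v)"
  shows "gw u \<approx> gw v"
  by (rule matsumoto[OF order_refl _ gw_nodes'[OF assms(1)] assms(3) gw_nodes'[OF assms(2)] assms(4)])
    (use start assms(5) in \<open>auto intro: less_imp_le\<close>)

lemma P_eqI:
  assumes "\<And>i. x i = y i"
  shows "P x = P y"
  using ext[of x y, OF assms] by simp

text \<open>The negation is already longest on its block, so appending \<open>g i\<close> is illegal
  and the argument goes through \<open>conjugate_word\<close>.\<close>

lemma negation_commute: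
  assumes "1 \<le> a" "a \<le> i" "i \<le> n"
  shows "gw (negation n a (nat (n + 1 - a))) @ g i \<approx> g i @ gw (negation n a (nat (n + 1 - a)))"
proof -
  define k where "k = nat (n + 1 - a)"
  have k: "a + int k = n + 1" "a + int k \<le> n + 1" using assms by (auto simp: k_def)
  define t :: "(int \<Rightarrow> int) \<Rightarrow> int \<Rightarrow> int" where
    "t x = (if i < n then x \<circ> transpose i (i + 1) else x(n := - x n, n + 1 := - x (n + 1)))" for x
  let ?x = "\<lambda>i. n + 1 - i"
  have gi: "play c (P x) (g i) = P (t x)" for x
    using g_play[of i x] gn_play[of x] assms by (auto simp: t_def)
  note p = gw_negation(1)[OF assms(1) k(2)] gi
  have i: "g i \<in> lists (nodes M)" using gw_nodes'[of "[i]"] assms by simp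
  have tt: "t (t x) = x" for x by (auto simp: t_def fun_eq_iff)
  have nt: "negate_at n a k (t ?x) = t (negate_at n a k ?x)"
    using assms k(1) by (auto simp: fun_eq_iff t_def negate_at_def transpose_def)
  show ?thesis unfolding k_def[symmetric]
  proof (rule conjugate_word)
    show "\<forall>i\<in>nodes M. 0 < P ?x i" using start by blast
    show "gw (negation n a k) \<in> lists (nodes M)"
      by (rule gw_nodes') (use set_negation[OF k(2)] assms in auto)
    show "legal c (P ?x) (gw (negation n a k))" using gw_negation(2)[OF assms(1) k(2)] by simp
    show "play c (P ?x) (g i @ gw (negation n a k)) = play c (P ?x) (gw (negation n a k) @ g i)"
      by (simp add: p nt)
    show "play c (P ?x) (gw (negation n a k) @ g i @ g i) = play c (P ?x) (gw (negation n a k))"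
      by (simp add: p tt)
    have "legal c (P (t (negate_at n a k ?x))) (g i)"
    proof (cases "i = n")
      case True
      then show ?thesis using assms k(1)
        by (simp add: t_def negate_at_def gn_legal)
    next
      case False
      then show ?thesis using assms k(1)
        by (intro g_legal) (auto simp: t_def negate_at_def)
    qed
    then show "legal c (play c (P ?x) (gw (negation n a k) @ g i)) (g i)" by (simp add: p)
  qed (use i in auto)
qed

text \<open>The exchange takes place to the left of the block. Both products stay legal, so
  \<open>word_eqI\<close> applies directly.\<close>

lemma negation_commute_low:
  assumes "1 \<le> i" "i + 1 < a" "a \<le> n + 1"
  shows "gw (negation n a (nat (n + 1 - a))) @ g i \<approx> g i @ gw (negation n a (nat (n + 1 - a)))"
proof -
  define k where "k = nat (n + 1 - a)"
  have a: "1 \<le> a" "a + int k \<le> n + 1" and i: "1 \<le> i" "i < n" using assms by (auto simp: k_def)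
  have "gw (negation n a k @ [i]) \<approx> gw ([i] @ negation n a k)"
    by (rule word_eqI) (use set_negation[OF a(2)] a assms in \<open>auto simp: gw_negation(1)[OF a]
      g_play[OF i] negate_at_def transpose_def
      intro!: g_legal gw_negation(2)[OF a] P_eqI\<close>)
  then show ?thesis by (simp add: k_def)
qed

lemma core_relation:
  assumes m: "2 * int m \<le> n"
  defines "A \<equiv> gw (reversal 1 (2 * m))" and "B \<equiv> gw (negation n (int m + 1) (nat (n - int m)))"
  shows "A @ B @ A @ B \<approx> B @ A @ B @ A"
proof -
  note [trans] = word_cong.trans
  note sym = word_cong.sym
  \<comment> \<open>The entries \<open>1..n\<close> form blocks of lengths \<open>m\<close>,
    \<open>m\<close> and \<open>l\<close>; below, \<open>x0\<close>, \<open>y0\<close> and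
    \<open>z0\<close> change the signs in the first, second and third block.\<close>
  define l where "l = nat (n - 2 * int m)"
  have l: "nat (n - int m) = m + l" "int l = n - 2 * int m" using m by (auto simp: l_def)
  define r0 where "r0 = reversal 1 m @ reversal (int m + 1) m"
  define s0 where "s0 = block_swap 1 m m"
  define x0 where "x0 = negation n 1 m"
  define y0 where "y0 = negation n (int m + 1) m"
  define z0 where "z0 = negation n (2 * int m + 1) l"
  note d = r0_def s0_def x0_def y0_def z0_def
  have B: "B = gw (y0 @ z0)"
    unfolding B_def l negation_add by (simp add: y0_def z0_def algebra_simps)
  have sub: "set r0 \<subseteq> {1..n}" "set s0 \<subseteq> {1..n}" "set x0 \<subseteq> {1..n}" "set y0 \<subseteq> {1..n}"
    "set z0 \<subseteq> {1..n}" "set (reversal 1 (2 * m)) \<subseteq> {1..n}"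
    using m l set_reversal[of 1 m] set_reversal[of "int m + 1" m] set_reversal[of 1 "2 * m"]
      set_block_swap[of 1 m m] set_negation[of 1 m n] set_negation[of "int m + 1" m n]
      set_negation[of "2 * int m + 1" l n] unfolding d by fastforce+
  note play = gw_reversal(1) gw_block_swap(1) gw_negation(1)
  note at = reverse_at_def swap_at_def negate_at_def
  have A1: "A \<approx> gw (r0 @ s0)" unfolding A_def
    by (rule word_eqI) (use sub m in \<open>auto simp: d play at
      intro!: gw_reversal(2) gw_block_swap(2) P_eqI\<close>)
  have A2: "A \<approx> gw (s0 @ r0)" unfolding A_def
    by (rule word_eqI) (use sub m in \<open>auto simp: d play at
      intro!: gw_reversal(2) gw_block_swap(2) P_eqI\<close>)
  have sys: "gw (s0 @ y0 @ s0) \<approx> gw x0"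
    by (rule word_eqI) (use sub m in \<open>auto simp: d play at
      intro!: gw_negation(2) gw_block_swap(2) P_eqI\<close>)
  have Bx: "gw ((y0 @ z0) @ x0) \<approx> gw (x0 @ (y0 @ z0))"
    by (rule word_eqI) (use sub m l in \<open>auto simp: d play at
      intro!: gw_negation(2) P_eqI\<close>)
  have zs: "gw (z0 @ s0) \<approx> gw (s0 @ z0)"
    by (rule word_eqI) (use sub m l in \<open>auto simp: d play at
      intro!: gw_negation(2) gw_block_swap(2) P_eqI\<close>)
  have yz: "gw (y0 @ z0) \<approx> gw (z0 @ y0)"
    by (rule word_eqI) (use sub m l in \<open>auto simp: d play at
      intro!: gw_negation(2) P_eqI\<close>)
  \<comment> \<open>This product is in general not legal, because letters of \<open>r0\<close>
    inside the second block are descents of \<open>B\<close>. So \<open>B\<close> is moved past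
    \<open>r0\<close> letter by letter; the letter \<open>int m\<close>, which straddles the
    boundary, does not occur.\<close>
  have Br: "B @ gw r0 \<approx> gw r0 @ B"
  proof -
    have "B @ gw u \<approx> gw u @ B" if "set u \<subseteq> {1..int m - 1} \<union> {int m + 1..2 * int m - 1}" for u
      using that
    proof (induction u)
      case Nil
      have "B \<in> lists (nodes M)" unfolding B by (rule gw_nodes') (use sub in simp)
      then show ?case using word_cong.refl by simp
    next
      case (Cons i u)
      have "set u \<subseteq> {1..n}" "{i} \<subseteq> {1..n}" using Cons.prems m by fastforce+
      then have i: "g i \<in> lists (nodes M)" "gw u \<in> lists (nodes M)"
        using gw_nodes'[of "[i]"] gw_nodes'[of u] by simp_all
      have "1 \<le> i \<and> i + 1 < int m + 1 \<or> int m + 1 \<le> i \<and> i \<le> n" using Cons.prems m by auto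
      then have "B @ g i \<approx> g i @ B"
        using m negation_commute[of "int m + 1" i] negation_commute_low[of i "int m + 1"]
        unfolding B_def by fastforce
      then have "(B @ g i) @ gw u \<approx> (g i @ B) @ gw u"
        by (rule word_cong_append2[OF _ word_cong.refl[OF i(2)]])
      moreover have "g i @ (B @ gw u) \<approx> g i @ (gw u @ B)"
        using word_cong_append2[OF word_cong.refl[OF i(1)] Cons.IH] Cons.prems by simp
      ultimately show ?case by (auto intro: word_cong.trans)
    qed
    moreover have "set r0 \<subseteq> {1..int m - 1} \<union> {int m + 1..2 * int m - 1}"
      using set_reversal[of 1 m] set_reversal[of "int m + 1" m] by (fastforce simp: r0_def)
    ultimately show ?thesis by blast
  qed
  define R S X Y Z where "R = gw r0" and "S = gw s0" and "X = gw x0" and "Y = gw y0" and "Z = gw z0"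
  note w = R_def S_def X_def Y_def Z_def
  have l': "R \<in> lists (nodes M)" "S \<in> lists (nodes M)" "X \<in> lists (nodes M)" "Y \<in> lists (nodes M)"
    "Z \<in> lists (nodes M)"
    unfolding w using gw_nodes' sub by blast+
  have BYZ: "B = Y @ Z" by (simp add: B w)
  note A1 = A1[simplified, folded w] and A2 = A2[simplified, folded w]
    and sys = sys[simplified, folded w] and Bx = Bx[simplified, folded w]
    and zs = zs[simplified, folded w] and yz = yz[simplified, folded w]
    and Br = Br[folded w, unfolded BYZ, simplified]
  note cong = word_cong_append
  \<comment> \<open>The first \<open>A\<close> is written as \<open>R @ S\<close>, the second as
    \<open>S @ R\<close>. After \<open>Z\<close> has passed \<open>S\<close>, the product
    \<open>S @ Y @ S\<close> appears and becomes \<open>X\<close>.\<close>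
  have AB: "A @ B @ A \<approx> R @ X @ Z @ R"
  proof -
    have "A @ B @ A \<approx> (R @ S) @ (Y @ Z) @ (S @ R)"
      unfolding BYZ
      by (intro word_cong_append2 A1 A2 word_cong.refl) (use l' in auto)
    also have "(R @ S) @ (Y @ Z) @ (S @ R) \<approx> R @ (S @ Y @ S) @ Z @ R"
      using cong[OF zs, of "R @ S @ Y" R] l' by simp
    also have "R @ (S @ Y @ S) @ Z @ R \<approx> R @ X @ Z @ R"
      using cong[OF sys, of R "Z @ R"] l' by simp
    finally show ?thesis .
  qed
  \<comment> \<open>The last factor \<open>B = Y @ Z\<close> travels to the front of
    \<open>R @ X @ Z @ R\<close>, passing each of its factors.\<close>
  have "A @ B @ A @ B \<approx> R @ X @ Z @ R @ Y @ Z"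
    using cong[OF AB, of "[]" B] l' by (simp add: BYZ)
  also have "R @ X @ Z @ R @ Y @ Z \<approx> R @ X @ Z @ Y @ Z @ R"
    using cong[OF sym[OF Br], of "R @ X @ Z" "[]"] l' by simp
  also have "R @ X @ Z @ Y @ Z @ R \<approx> R @ X @ Y @ Z @ Z @ R"
    using cong[OF sym[OF yz], of "R @ X" "Z @ R"] l' by simp
  also have "R @ X @ Y @ Z @ Z @ R \<approx> R @ Y @ Z @ X @ Z @ R"
    using cong[OF sym[OF Bx], of R "Z @ R"] l' by simp
  also have "R @ Y @ Z @ X @ Z @ R \<approx> Y @ Z @ R @ X @ Z @ R"
    using cong[OF sym[OF Br], of "[]" "X @ Z @ R"] l' by simp
  also have "Y @ Z @ R @ X @ Z @ R \<approx> B @ A @ B @ A"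
    using cong[OF sym[OF AB], of "Y @ Z" "[]"] l' by (simp add: BYZ)
  finally show ?thesis .
qed

end

section \<open>Type B\<close>

text \<open>The \<open>-2\<close> reflects that flipping \<open>x n\<close> raises
  \<open>x (n - 1) - x n\<close> by \<open>2 * x n\<close>. Since \<open>g_play\<close> equates
  functions on all integers, the chain continues to the left of \<open>1\<close>, and integers
  beyond \<open>n\<close> are isolated.\<close>

definition cartan_B :: "int \<Rightarrow> int \<Rightarrow> int \<Rightarrow> int" where
  "cartan_B n i j = (if i = j then 2 else if i = n \<and> j = n - 1 then -2
     else if \<bar>i - j\<bar> = 1 \<and> i \<le> n \<and> j \<le> n then -1 else 0)"

definition position_B :: "int \<Rightarrow> (int \<Rightarrow> int) \<Rightarrow> int \<Rightarrow> int" where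
  "position_B n x i = (if i < n then x i - x (i + 1) else if i = n then x i else 0)"

lemma signed_chain_B:
  assumes "1 \<le> n"
  shows "signed_chain (type_B n) (cartan_B n) (position_B n) (\<lambda>i. [i]) n"
proof
  fix i j assume "i \<in> nodes (type_B n)" "j \<in> nodes (type_B n)" "i \<noteq> j"
  then show "entry (type_B n) i j = 2 \<and> cartan_B n i j = 0 \<and> cartan_B n j i = 0 \<or>
      entry (type_B n) i j = 3 \<and> cartan_B n i j = -1 \<and> cartan_B n j i = -1 \<or>
      entry (type_B n) i j = 4 \<and> cartan_B n i j * cartan_B n j i = 2 \<and> cartan_B n i j < 0"
    by (auto simp: type_B_def cartan_B_def doubleton_eq_iff)
next
  show "is_coxeter_matrix (type_B n)" by (rule is_coxeter_matrix_type_B)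
qed (use assms in \<open>auto simp: type_B_def cartan_B_def position_B_def fire_def
    fun_eq_iff transpose_def\<close>)

lemma B2_hom_type_B:
  assumes m: "0 \<le> m" "J \<subseteq> {1..m - 1}" and n: "2 \<le> n" "2 * m \<le> n" and K: "K \<subseteq> {2 * m + 1..n}"
  shows "\<exists>h \<in> monoid_hom (artin_monoid (type_B 2)) (artin_monoid (type_B n)).
           h (artin_gen (type_B 2) 1) = T_longest (type_B n) ({1..2 * m - 1} \<union> K) \<and>
           h (artin_gen (type_B 2) 2) = T_longest (type_B n) ({m + 1..n} \<union> J)"
proof -
  interpret B: signed_chain "type_B n" "cartan_B n" "position_B n" "\<lambda>i. [i]" n
    using n by (intro signed_chain_B) simp
  define k where "k = nat m"
  have k: "m = int k" using m by (simp add: k_def)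
  let ?p = "reversal 1 (2 * k)" and ?q = "negation n (int k + 1) (nat (n - int k))"
  have p: "B.is_longest {1..2 * m - 1} ?p"
    using B.is_longest_reversal[of 1 "2 * k"] n(2) by (simp add: k)
  have q: "B.is_longest {m + 1..n} ?q"
    using B.is_longest_negation[of "int k + 1" "nat (n - int k)"] n m by (simp add: k)
  show ?thesis
  \<comment> \<open>The reversal of \<open>2 * m\<close> entries mirrors its letters, while the
    negation commutes with all of its own; so \<open>K\<close> stays fixed.\<close>
  proof (rule B.B2_hom_longest[OF p q, where \<sigma> = "\<lambda>i. 2 * m - i" and \<tau> = id])
    show "B.braid_eq (?p @ ?q @ ?p @ ?q) (?q @ ?p @ ?q @ ?p)"
      using B.core_relation[of k] n by (simp add: k)
    show "B.is_longest (nodes (type_B n)) (negation n 1 (nat n))"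
      using B.is_longest_negation[of 1 "nat n"] n by (simp add: type_B_def)
    show "\<forall>i\<in>{1..2 * m - 1}. B.braid_eq (?p @ [i]) ([2 * m - i] @ ?p)"
      using B.reversal_conjugate[of 1 "2 * k"] n by (simp add: k)
    show "\<forall>i\<in>{m + 1..n}. B.braid_eq (?q @ [i]) ([id i] @ ?q)"
      using B.negation_commute[of "int k + 1"] m by (simp add: k)
    show "(\<lambda>i. 2 * m - i) ` (\<lambda>i. 2 * m - i) ` J = J" by (simp add: image_image)
  qed (use m n K in \<open>auto simp: cartan_B_def type_B_def orthogonal_def weakly_orthogonal_def
      doubleton_eq_iff\<close>)
qed

section \<open>Type D\<close>

definition cartan_D :: "int \<Rightarrow> int \<Rightarrow> int \<Rightarrow> int" where
  "cartan_D n i j = (if i = j then 2 else if {i, j} = {n - 1, n + 1} then -1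
     else if \<bar>i - j\<bar> = 1 \<and> i \<le> n \<and> j \<le> n then -1 else 0)"

definition position_D :: "int \<Rightarrow> (int \<Rightarrow> int) \<Rightarrow> int \<Rightarrow> int" where
  "position_D n x i = (if i \<le> n then x i - x (i + 1) else if i = n + 1 then x n + x (n + 1) else 0)"

text \<open>Folding onto type B: the commuting fork nodes \<open>n\<close> and \<open>n + 1\<close>
  together flip \<open>x n\<close> and \<open>x (n + 1)\<close>.\<close>

definition word_D :: "int \<Rightarrow> int \<Rightarrow> int list" where
  "word_D n i = (if i = n then [n, n + 1] else [i])"

lemma support_word_D:
  "a \<le> n \<Longrightarrow> (\<Union>i\<in>{a..n}. set (word_D n i)) = {a..n + 1}"
  "b < n \<Longrightarrow> (\<Union>i\<in>{a..b}. set (word_D n i)) = {a..b}"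
proof -
  have *: "(\<Union>i\<in>{a..b}. set (word_D n i)) = {a..b}" if "b < n" for b
    using that by (force simp: word_D_def)
  then show "b < n \<Longrightarrow> (\<Union>i\<in>{a..b}. set (word_D n i)) = {a..b}" .
  assume "a \<le> n"
  then have "{a..n} = insert n {a..n - 1}" "{a..n + 1} = {n, n + 1} \<union> {a..n - 1}" by auto
  then show "(\<Union>i\<in>{a..n}. set (word_D n i)) = {a..n + 1}"
    using *[of "n - 1"] by (simp add: word_D_def)
qed

lemma signed_chain_D:
  assumes "2 \<le> n"
  shows "signed_chain (type_D (n + 1)) (cartan_D n) (position_D n) (word_D n) n"
proof
  fix i j assume "i \<in> nodes (type_D (n + 1))" "j \<in> nodes (type_D (n + 1))" "i \<noteq> j"
  then show "entry (type_D (n + 1)) i j = 2 \<and> cartan_D n i j = 0 \<and> cartan_D n j i = 0 \<or>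
      entry (type_D (n + 1)) i j = 3 \<and> cartan_D n i j = -1 \<and> cartan_D n j i = -1 \<or>
      entry (type_D (n + 1)) i j = 4 \<and> cartan_D n i j * cartan_D n j i = 2 \<and> cartan_D n i j < 0"
    by (auto simp: type_D_def cartan_D_def doubleton_eq_iff)
next
  show "nodes (type_D (n + 1)) = (\<Union>i\<in>{1..n}. set (word_D n i))"
    using assms support_word_D(1)[of 1 n] by (simp add: type_D_def)
next
  show "is_coxeter_matrix (type_D (n + 1))" by (rule is_coxeter_matrix_type_D)
qed (use assms in \<open>auto simp: type_D_def cartan_D_def position_D_def fire_def
    word_D_def doubleton_eq_iff fun_eq_iff transpose_def\<close>)

text \<open>The effect of a single node. It is needed since \<open>word_D\<close> joins the two fork
  nodes, whereas conjugation can interchange them.\<close>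

definition reflect_D :: "int \<Rightarrow> int \<Rightarrow> (int \<Rightarrow> int) \<Rightarrow> int \<Rightarrow> int" where
  "reflect_D n j x = (if j \<le> n then x \<circ> transpose j (j + 1) else x(n := - x (n + 1), n + 1 := - x n))"

lemma play_D:
  assumes "1 \<le> j" "j \<le> n + 1"
  shows "play (cartan_D n) (position_D n x) [j] = position_D n (reflect_D n j x)"
proof -
  have "j = n + 1 \<or> j \<le> n" using assms by auto
  then show ?thesis
    by (auto simp: reflect_D_def cartan_D_def position_D_def fire_def doubleton_eq_iff fun_eq_iff
      transpose_def)
qed

text \<open>For odd \<open>k\<close> all entries from \<open>a\<close> to \<open>n + 1\<close>
  change sign, which is central. For even \<open>k\<close> the entry at \<open>n + 1\<close> keeps
  its sign, and this interchanges the fork nodes.\<close>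

lemma negation_conjugate_D:
  assumes n: "2 \<le> n" and a: "1 \<le> a" "a + int k = n + 1" "1 \<le> k" and j: "a \<le> j" "j \<le> n + 1"
  defines "q \<equiv> concat (map (word_D n) (negation n a k))"
    and "\<tau> \<equiv> (if even k then transpose n (n + 1) else id)"
  shows "(q @ [j], [\<tau> j] @ q) \<in> word_cong (nodes (type_D (n + 1))) (braid_relations (type_D (n + 1)))"
proof -
  interpret D: signed_chain "type_D (n + 1)" "cartan_D n" "position_D n" "word_D n" n
    by (rule signed_chain_D[OF n])
  let ?x = "\<lambda>i. n + 1 - i" and ?t = "reflect_D n"
  have ak: "a + int k \<le> n + 1" using a by simp
  have \<tau>j: "1 \<le> \<tau> j" "\<tau> j \<le> n + 1" "1 \<le> j"
    using j a n by (auto simp: \<tau>_def transpose_def)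
  note p = D.gw_negation(1)[OF a(1) ak, folded q_def]
    play_D[OF \<tau>j(1,2), simplified] play_D[OF \<tau>j(3) j(2), simplified]
  have tt: "?t j (?t j x) = x" for x
    by (auto simp: reflect_D_def fun_eq_iff)
  have nt: "negate_at n a k (?t (\<tau> j) ?x) = ?t j (negate_at n a k ?x)"
    using a j n by (auto simp: fun_eq_iff reflect_D_def negate_at_def transpose_def \<tau>_def)
  show ?thesis
  proof (rule D.conjugate_word)
    show "\<forall>i\<in>nodes (type_D (n + 1)). 0 < position_D n ?x i" using D.start by blast
    show "q \<in> lists (nodes (type_D (n + 1)))"
      unfolding q_def by (rule D.gw_nodes') (use set_negation[OF ak] a in auto)
    show "legal (cartan_D n) (position_D n ?x) q"
      unfolding q_def using D.gw_negation(2)[OF a(1) ak] by simp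
    show "[j] \<in> lists (nodes (type_D (n + 1)))" "[\<tau> j] \<in> lists (nodes (type_D (n + 1)))"
      using \<tau>j j by (auto simp: type_D_def)
    show "play (cartan_D n) (position_D n ?x) ([\<tau> j] @ q) = play (cartan_D n) (position_D n ?x) (q @ [j])"
      by (simp add: p nt)
    show "play (cartan_D n) (position_D n ?x) (q @ [j] @ [j]) = play (cartan_D n) (position_D n ?x) q"
      by (simp add: p tt)
    show "legal (cartan_D n) (play (cartan_D n) (position_D n ?x) (q @ [j])) [j]"
    proof -
      have "play (cartan_D n) (position_D n ?x) (q @ [j]) = position_D n (?t j (negate_at n a k ?x))"
        by (simp add: p)
      moreover consider "j < n" | "j = n" | "j = n + 1" using j by linarith
      then have "0 < position_D n (?t j (negate_at n a k ?x)) j"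
        using a j n by cases (auto simp: position_D_def reflect_D_def negate_at_def transpose_def)
      ultimately show ?thesis by simp
    qed
  qed simp
qed

lemma B2_hom_type_D:
  assumes m: "0 \<le> m" "J \<subseteq> {1..m - 1}" and n: "3 \<le> n" "2 * m \<le> n"
    and K: "K \<subseteq> {2 * m + 1..n + 1}" "n = 2 * m \<longrightarrow> n + 1 \<notin> K"
      "even (n - m) \<longrightarrow> weakly_orthogonal (type_D (n + 1)) K (transpose n (n + 1) ` K)"
  shows "\<exists>h \<in> monoid_hom (artin_monoid (type_B 2)) (artin_monoid (type_D (n + 1))).
           h (artin_gen (type_B 2) 1) = T_longest (type_D (n + 1)) ({1..2 * m - 1} \<union> K) \<and>
           h (artin_gen (type_B 2) 2) = T_longest (type_D (n + 1)) ({m + 1..n + 1} \<union> J)"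
proof -
  interpret D: signed_chain "type_D (n + 1)" "cartan_D n" "position_D n" "word_D n" n
    using n by (intro signed_chain_D) simp
  define k where "k = nat m"
  have k: "m = int k" using m by (simp add: k_def)
  let ?p = "concat (map (word_D n) (reversal 1 (2 * k)))"
  let ?q = "concat (map (word_D n) (negation n (int k + 1) (nat (n - int k))))"
  define \<tau> where "\<tau> = (if even (n - m) then transpose n (n + 1) else id)"
  have p: "D.is_longest {1..2 * m - 1} ?p"
    using D.is_longest_reversal[of 1 "2 * k"] support_word_D(2)[of "2 * m - 1" n 1] n(2) by (simp add: k)
  have q: "D.is_longest {m + 1..n + 1} ?q"
    using D.is_longest_negation[of "int k + 1" "nat (n - int k)"] support_word_D(1)[of "int k + 1" n] n m
    by (simp add: k)
  \<comment> \<open>If \<open>\<tau>\<close> moves \<open>n + 1\<close> to \<open>n\<close>, the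
    latter still has to be at least \<open>2 * m + 1\<close>.\<close>
  have "n + 1 \<in> K \<Longrightarrow> 2 * m < n" using K(2) n(2) by (cases "n = 2 * m") auto
  then have \<tau>K: "\<tau> ` K \<subseteq> {2 * m + 1..n + 1}" "n = 2 * m \<longrightarrow> n + 1 \<notin> \<tau> ` K"
    using K(1,2) by (auto simp: \<tau>_def transpose_def subset_eq)
  have \<tau>J: "\<tau> i = i" if "i < n" for i using that by (auto simp: \<tau>_def transpose_def)
  \<comment> \<open>The only neighbour of \<open>n + 1\<close> is \<open>n - 1\<close>, which lies
    in the interval just when \<open>n = 2 * m\<close>.\<close>
  have orth: "orthogonal (type_D (n + 1)) L {1..2 * m - 1}"
    if "L \<subseteq> {2 * m + 1..n + 1}" "n = 2 * m \<longrightarrow> n + 1 \<notin> L" for L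
    unfolding orthogonal_def
  proof (intro ballI)
    fix l i assume l: "l \<in> L" and i: "i \<in> {1..2 * m - 1}"
    then have "2 * m + 1 \<le> l" "l = n + 1 \<longrightarrow> n \<noteq> 2 * m" using that by auto
    then show "entry (type_D (n + 1)) l i = 2"
      using i n by (auto simp: type_D_def doubleton_eq_iff)
  qed
  show ?thesis
  proof (rule D.B2_hom_longest[OF p q, where \<sigma> = "\<lambda>i. 2 * m - i" and \<tau> = \<tau>])
    show "D.braid_eq (?p @ ?q @ ?p @ ?q) (?q @ ?p @ ?q @ ?p)"
      using D.core_relation[of k] n by (simp add: k)
    show "D.is_longest (nodes (type_D (n + 1))) (concat (map (word_D n) (negation n 1 (nat n))))"
      using D.is_longest_negation[of 1 "nat n"] n D.nodes_eq by simp
    show "\<forall>i\<in>{1..2 * m - 1}. D.braid_eq (?p @ [i]) ([2 * m - i] @ ?p)"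
    proof
      fix i assume "i \<in> {1..2 * m - 1}"
      then show "D.braid_eq (?p @ [i]) ([2 * m - i] @ ?p)"
        using D.reversal_conjugate[of 1 "2 * k" i] n by (simp add: k word_D_def)
    qed
    show "\<forall>i\<in>{m + 1..n + 1}. D.braid_eq (?q @ [i]) ([\<tau> i] @ ?q)"
    proof
      fix i assume i: "i \<in> {m + 1..n + 1}"
      have "even (nat (n - int k)) \<longleftrightarrow> even (n - m)" using n m by (simp add: k even_nat_iff)
      then show "D.braid_eq (?q @ [i]) ([\<tau> i] @ ?q)"
        using negation_conjugate_D[of n "int k + 1" "nat (n - int k)" i] n m(1) i
        by (simp add: k \<tau>_def del: append_Cons)
    qed
    show "(\<lambda>i. 2 * m - i) ` (\<lambda>i. 2 * m - i) ` J = J" by (simp add: image_image)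
    show "orthogonal (type_D (n + 1)) K {1..2 * m - 1}" "orthogonal (type_D (n + 1)) (\<tau> ` K) {1..2 * m - 1}"
      by (rule orth[OF K(1,2)], rule orth[OF \<tau>K])
    show "\<forall>i\<in>{m + 1..n + 1}. \<forall>j\<in>{m + 1..n + 1}. cartan_D n (\<tau> i) (\<tau> j) = cartan_D n i j"
      using n by (auto simp: cartan_D_def \<tau>_def transpose_def doubleton_eq_iff)
    show "weakly_orthogonal (type_D (n + 1)) K (\<tau> ` K)"
      using K(3) by (auto simp: \<tau>_def weakly_orthogonal_def orthogonal_def)
    show "\<tau> ` \<tau> ` K = K" by (auto simp: \<tau>_def image_image)
    show "\<tau> ` (\<lambda>i. 2 * m - i) ` J = (\<lambda>i. 2 * m - i) ` J"
    proof -
      have "\<forall>i\<in>(\<lambda>i. 2 * m - i) ` J. \<tau> i = i" using \<tau>J m n by fastforce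
      then show ?thesis by (simp add: image_image)
    qed
    show "orthogonal (type_D (n + 1)) J {m + 1..n + 1}"
      using m n by (force simp: orthogonal_def type_D_def doubleton_eq_iff)
    show "K \<subseteq> {m + 1..n + 1}" "\<tau> ` K \<subseteq> {m + 1..n + 1}" using K(1) \<tau>K(1) m by auto
  qed (use m n in \<open>auto simp: cartan_D_def doubleton_eq_iff\<close>)
qed

section \<open>Type A\<close>

definition cartan_A :: "int \<Rightarrow> int \<Rightarrow> int" where
  "cartan_A i j = (if i = j then 2 else if \<bar>i - j\<bar> = 1 then -1 else 0)"

definition position_A :: "(int \<Rightarrow> int) \<Rightarrow> int \<Rightarrow> int" where
  "position_A x i = x i - x (i + 1)"

lemma chain_A: "chain (type_A n) cartan_A position_A (\<lambda>i. [i]) (n + 1) 0"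
proof
  show "is_coxeter_matrix (type_A n)" by (rule is_coxeter_matrix_type_A)
qed (auto simp: type_A_def cartan_A_def position_A_def fire_def fun_eq_iff transpose_def)

text \<open>Folding: an antisymmetric sequence of length \<open>n + 1\<close> is determined by its left half
  \<open>x 1, \<dots>, x k\<close>; for even \<open>n\<close> its middle entry is \<open>0\<close>.\<close>

definition unfold_A :: "int \<Rightarrow> int \<Rightarrow> (int \<Rightarrow> int) \<Rightarrow> int \<Rightarrow> int" where
  "unfold_A n k x j = (if j \<le> k then x j else if n + 2 - k \<le> j then - x (n + 2 - j) else 0)"

text \<open>Each orbit of the diagram flip contributes its longest word: two commuting letters, or
  the middle letter, or for even \<open>n\<close> the longest word on the two middle nodes.\<close>

definition word_A :: "int \<Rightarrow> int \<Rightarrow> int \<Rightarrow> int list" where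
  "word_A n k i = (if i < k then [i, n + 1 - i] else if odd n then [k] else [k, k + 1, k])"

lemma support_word_A:
  assumes k: "1 \<le> k" "n = 2 * k - 1 \<or> n = 2 * k"
  shows "a \<le> k \<Longrightarrow> (\<Union>i\<in>{a..k}. set (word_A n k i)) = {a..n + 1 - a}"
    and "b < k \<Longrightarrow> (\<Union>i\<in>{a..b}. set (word_A n k i)) = {a..b} \<union> {n + 1 - b..n + 1 - a}"
proof -
  have *: "(\<Union>i\<in>{a..b}. set (word_A n k i)) = {a..b} \<union> {n + 1 - b..n + 1 - a}" if "b < k" for b
  proof -
    have "(\<Union>i\<in>{a..b}. set (word_A n k i)) = (\<Union>i\<in>{a..b}. {i} \<union> {n + 1 - i})"
      using that by (intro SUP_cong) (auto simp: word_A_def)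
    also have "\<dots> = {a..b} \<union> (\<lambda>i. n + 1 - i) ` {a..b}" by blast
    finally show ?thesis by simp
  qed
  then show "b < k \<Longrightarrow> (\<Union>i\<in>{a..b}. set (word_A n k i)) = {a..b} \<union> {n + 1 - b..n + 1 - a}" .
  assume "a \<le> k"
  then have "{a..k} = insert k {a..k - 1}" by auto
  then have "(\<Union>i\<in>{a..k}. set (word_A n k i))
      = set (word_A n k k) \<union> ({a..k - 1} \<union> {n + 1 - (k - 1)..n + 1 - a})"
    using *[of "k - 1"] by simp
  also have "\<dots> = {a..n + 1 - a}"
    using k \<open>a \<le> k\<close> by (auto simp: word_A_def split: if_splits)
  finally show "(\<Union>i\<in>{a..k}. set (word_A n k i)) = {a..n + 1 - a}" .
qed

lemma signed_chain_A:
  assumes k: "1 \<le> k" "n = 2 * k - 1 \<or> n = 2 * k"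
  shows "signed_chain (type_A n) cartan_A (\<lambda>x. position_A (unfold_A n k x)) (word_A n k) k"
proof -
  interpret A: chain "type_A n" cartan_A position_A "\<lambda>i. [i]" "n + 1" 0 by (rule chain_A)
  have step: "play cartan_A (position_A y) (i # u)
      = play cartan_A (position_A (y \<circ> transpose i (i + 1))) u"
    "legal cartan_A (position_A y) (i # u)
      \<longleftrightarrow> y (i + 1) < y i \<and> legal cartan_A (position_A (y \<circ> transpose i (i + 1))) u"
    if "1 \<le> i" "i \<le> n" for y i u
  proof -
    have "fire cartan_A i (position_A y) = position_A (y \<circ> transpose i (i + 1))"
      using A.g_play[of i y] that by simp
    then show "play cartan_A (position_A y) (i # u)
      = play cartan_A (position_A (y \<circ> transpose i (i + 1))) u"
      "legal cartan_A (position_A y) (i # u)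
      \<longleftrightarrow> y (i + 1) < y i \<and> legal cartan_A (position_A (y \<circ> transpose i (i + 1))) u"
      by (auto simp: position_A_def)
  qed
  have low: "i + 1 \<le> k" "1 \<le> i" "i \<le> n" "1 \<le> n + 1 - i" "n + 1 - i \<le> n" "i + 1 < n + 1 - i"
    if "1 \<le> i" "i < k" for i using that k by auto
  show ?thesis
  proof
    fix i assume i: "1 \<le> i" "i < k"
    note l = low[OF i]
    show "word_A n k i \<in> lists (nodes (type_A n))" using l i by (auto simp: word_A_def type_A_def)
    fix x
    \<comment> \<open>Exchanging the mirrored neighbours as well keeps the sequence
      antisymmetric.\<close>
    have "unfold_A n k x \<circ> transpose i (i + 1) \<circ> transpose (n + 1 - i) (n + 1 - i + 1)
        = unfold_A n k (x \<circ> transpose i (i + 1))"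
      using l k by (auto simp: unfold_A_def fun_eq_iff transpose_def intro!: arg_cong[of _ _ x])
    then show "play cartan_A (position_A (unfold_A n k x)) (word_A n k i)
        = position_A (unfold_A n k (x \<circ> transpose i (i + 1)))"
      using i by (simp add: word_A_def step l del: play.simps(2))
    have u: "unfold_A n k x i = x i" "unfold_A n k x (i + 1) = x (i + 1)"
      "unfold_A n k x (n + 1 - i) = - x (i + 1)" "unfold_A n k x (n + 1 - i + 1) = - x i"
      using l k by (auto simp: unfold_A_def algebra_simps)
    show "legal cartan_A (position_A (unfold_A n k x)) (word_A n k i)" if "x (i + 1) < x i"
      using that l i u by (simp add: word_A_def step transpose_def del: legal.simps(2))
    show "position_A (unfold_A n k x) j \<le> 0" if "x i \<le> x (i + 1)" "j \<in> set (word_A n k i)" for j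
    proof -
      have "j = i \<or> j = n + 1 - i" using that(2) i by (auto simp: word_A_def)
      then show ?thesis using that(1) u unfolding position_A_def by fastforce
    qed
  next
    fix x
    \<comment> \<open>The mirror image of place \<open>k\<close> is its neighbour for odd
      \<open>n\<close>; for even \<open>n\<close> the middle entry \<open>0\<close> lies between
      them.\<close>
    have odd: "k + 1 = n + 2 - k" if "odd n" using that k by auto
    have even: "k + 2 = n + 2 - k" if "even n" using that k by auto
    have kn: "1 \<le> k" "0 \<le> k" "k \<le> n" "even n \<Longrightarrow> k + 1 \<le> n" using k by auto
    show "play cartan_A (position_A (unfold_A n k x)) (word_A n k k)
        = position_A (unfold_A n k (x(k := - x k, k + 1 := - x (k + 1))))"
    proof (cases "odd n")
      case True
      then have "unfold_A n k x \<circ> transpose k (k + 1)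
          = unfold_A n k (x(k := - x k, k + 1 := - x (k + 1)))"
        using odd k by (auto simp: unfold_A_def fun_eq_iff transpose_def intro!: arg_cong[of _ _ x])
      then show ?thesis using True by (simp add: word_A_def step kn del: play.simps(2))
    next
      case False
      \<comment> \<open>The three transpositions exchange the entries at \<open>k\<close> and
        \<open>k + 2\<close> across the middle.\<close>
      then have "unfold_A n k x \<circ> transpose k (k + 1) \<circ> transpose (k + 1) (k + 1 + 1)
            \<circ> transpose k (k + 1)
          = unfold_A n k (x(k := - x k, k + 1 := - x (k + 1)))"
        using even k by (auto simp: unfold_A_def fun_eq_iff transpose_def)
      then show ?thesis using False by (simp add: word_A_def step kn del: play.simps(2))
    qed
    show "legal cartan_A (position_A (unfold_A n k x)) (word_A n k k)" if "\<bar>x (k + 1)\<bar> < x k"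
    proof (cases "odd n")
      case True
      then have "n + 2 - (k + 1) = k" using odd by simp
      then have "unfold_A n k x (k + 1) = - x k" using k by (auto simp: unfold_A_def intro!: arg_cong[of _ _ x])
      moreover have "unfold_A n k x k = x k" by (simp add: unfold_A_def)
      ultimately show ?thesis
        using that True by (simp add: word_A_def step kn del: legal.simps(2))
    next
      case False
      then have "n - k = k" using even by simp
      with False show ?thesis using that even
        by (simp add: word_A_def step kn unfold_A_def transpose_def del: legal.simps(2))
    qed
    show "position_A (unfold_A n k x) j \<le> 0" if "x k \<le> - \<bar>x (k + 1)\<bar>" "j \<in> set (word_A n k k)" for j
    proof (cases "odd n")
      case True
      then have n: "n = 2 * k - 1" using odd by simp
      show ?thesis using that k(1)
        by (auto simp: n word_A_def position_A_def unfold_A_def)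
    next
      case False
      then have "n - k = k" using even by simp
      with False show ?thesis using that k
        by (auto simp: word_A_def position_A_def unfold_A_def)
    qed
    show "nodes (type_A n) = (\<Union>i\<in>{1..k}. set (word_A n k i))"
      using support_word_A(1)[OF k, of 1] k by (simp add: type_A_def)
  next
    fix j assume "j \<in> nodes (type_A n)"
    then show "0 < position_A (unfold_A n k (\<lambda>i. k + 1 - i)) j"
      using k by (auto simp: position_A_def unfold_A_def type_A_def)
  qed (use k in auto)
qed

lemma B2_hom_type_A:
  assumes m: "0 \<le> m" "J \<subseteq> {1..m - 1}" and n: "1 \<le> n" "4 * m - 1 \<le> n"
    and K: "K \<subseteq> {2 * m + 1..n - 2 * m}" "weakly_orthogonal (type_A n) K ((\<lambda>k. n + 1 - k) ` K)"
  shows "\<exists>h \<in> monoid_hom (artin_monoid (type_B 2)) (artin_monoid (type_A n)).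
           h (artin_gen (type_B 2) 1) =
             T_longest (type_A n) ({1..2 * m - 1} \<union> {n + 2 - 2 * m..n} \<union> K) \<and>
           h (artin_gen (type_B 2) 2) =
             T_longest (type_A n) ({m + 1..n - m} \<union> J \<union> (\<lambda>j. n + 1 - j) ` J)"
proof -
  \<comment> \<open>The rank of the folded diagram; \<open>4 * m - 1 \<le> n\<close> becomes
    \<open>2 * m \<le> k\<close>.\<close>
  define k where "k = (n + 1) div 2"
  have k: "1 \<le> k" "n = 2 * k - 1 \<or> n = 2 * k" "2 * m \<le> k" using n by (auto simp: k_def)
  interpret A: chain "type_A n" cartan_A position_A "\<lambda>i. [i]" "n + 1" 0 by (rule chain_A)
  interpret S: signed_chain "type_A n" cartan_A "\<lambda>x. position_A (unfold_A n k x)" "word_A n k" k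
    by (rule signed_chain_A[OF k(1,2)])
  define M where "M = nat m"
  have M: "m = int M" using m by (simp add: M_def)
  let ?P1 = "{1..2 * m - 1}" and ?P2 = "{n + 2 - 2 * m..n}" and ?Q = "{m + 1..n - m}"
  let ?J = "J \<union> (\<lambda>j. n + 1 - j) ` J"
  let ?p = "concat (map (word_A n k) (reversal 1 (2 * M)))"
  let ?q = "concat (map (word_A n k) (negation k (int M + 1) (nat (k - int M))))"
  \<comment> \<open>Folded words only see whole orbits. Conjugation of single letters is computed
    with these unfolded reversals for the same sets of nodes.\<close>
  let ?p1 = "reversal 1 (2 * M)" and ?p2 = "reversal (n + 2 - 2 * m) (2 * M)"
  let ?q' = "reversal (m + 1) (nat (n - 2 * m + 1))"
  \<comment> \<open>The intervals \<open>?P1\<close> and \<open>?P2\<close> are mirrored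
    separately.\<close>
  define \<sigma> where "\<sigma> i = (if i \<le> 2 * m - 1 then 2 * m - i else 2 * n + 2 - 2 * m - i)" for i
  have p: "A.is_longest (?P1 \<union> ?P2) ?p"
    using S.is_longest_reversal[of 1 "2 * M"] support_word_A(2)[OF k(1,2), of "2 * m - 1" 1] k(3)
    by (simp add: M algebra_simps)
  have q: "A.is_longest ?Q ?q"
    using S.is_longest_negation[of "int M + 1" "nat (k - int M)"] k m
      support_word_A(1)[OF k(1,2), of "m + 1"] by (cases "m = k") (auto simp: M)
  have p1: "A.is_longest ?P1 ?p1"
    using A.is_longest_reversal[of 1 "2 * M"] n m by (simp add: M)
  have p2: "A.is_longest ?P2 ?p2"
    using A.is_longest_reversal[of "n + 2 - 2 * m" "2 * M"] n m by (simp add: M)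
  have q': "A.is_longest ?Q ?q'"
    using A.is_longest_reversal[of "m + 1" "nat (n - 2 * m + 1)"] n m by simp
  have orth: "orthogonal (type_A n) ?P1 ?P2"
    using n by (auto simp: orthogonal_def type_A_def)
  have \<sigma>1: "\<forall>i\<in>?P1. A.braid_eq (?p1 @ [i]) ([\<sigma> i] @ ?p1) \<and> \<sigma> i \<in> ?P1"
    using A.reversal_conjugate[of 1 "2 * M"] n m by (auto simp: M \<sigma>_def)
  have \<sigma>2: "\<forall>i\<in>?P2. A.braid_eq (?p2 @ [i]) ([\<sigma> i] @ ?p2) \<and> \<sigma> i \<in> ?P2"
  proof
    fix i assume i: "i \<in> ?P2"
    then have "\<sigma> i = 2 * (n + 2 - 2 * m) + int (2 * M) - 2 - i" "\<sigma> i \<in> ?P2"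
      using n by (auto simp: \<sigma>_def M)
    then show "A.braid_eq (?p2 @ [i]) ([\<sigma> i] @ ?p2) \<and> \<sigma> i \<in> ?P2"
      using A.reversal_conjugate[of "n + 2 - 2 * m" "2 * M" i] i n m by (simp add: M)
  qed
  show ?thesis unfolding Un_assoc[of _ J]
  \<comment> \<open>\<open>?Q\<close> is symmetric about the middle of the diagram, so its longest
    element induces the flip \<open>i \<mapsto> n + 1 - i\<close>.\<close>
  proof (rule A.B2_hom_longest[OF p q, where \<sigma> = \<sigma> and \<tau> = "\<lambda>i. n + 1 - i"])
    show "A.braid_eq (?p @ ?q @ ?p @ ?q) (?q @ ?p @ ?q @ ?p)"
      using S.core_relation[of M] k by (simp add: M)
    show "A.is_longest (nodes (type_A n)) (concat (map (word_A n k) (negation k 1 (nat k))))"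
      using S.is_longest_negation[of 1 "nat k"] k(1) S.nodes_eq by simp
    show "\<forall>i\<in>?P1 \<union> ?P2. A.braid_eq (?p @ [i]) ([\<sigma> i] @ ?p)"
    proof
      fix i assume i: "i \<in> ?P1 \<union> ?P2"
      then have "[i] \<in> lists (nodes (type_A n))" using n m by (auto simp: type_A_def)
      then show "A.braid_eq (?p @ [i]) ([\<sigma> i] @ ?p)"
        using A.conjugation_transfer[OF A.is_longest_Un[OF orth p1 p2] p
          A.conjugation_Un[OF orth p1 p2 \<sigma>1 \<sigma>2 i]] by simp
    qed
    show "\<forall>i\<in>?Q. A.braid_eq (?q @ [i]) ([n + 1 - i] @ ?q)"
    proof
      fix i assume i: "i \<in> ?Q"
      then have "[i] \<in> lists (nodes (type_A n))" using n m by (auto simp: type_A_def)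
      moreover have "A.braid_eq (?q' @ [i]) ([n + 1 - i] @ ?q')"
        using A.reversal_conjugate[of "m + 1" "nat (n - 2 * m + 1)" i] i n m by (simp add: algebra_simps)
      ultimately show "A.braid_eq (?q @ [i]) ([n + 1 - i] @ ?q)"
        using A.conjugation_transfer[OF q' q] by blast
    qed
    show "\<forall>i\<in>?P1 \<union> ?P2. \<forall>j\<in>?P1 \<union> ?P2. cartan_A (\<sigma> i) (\<sigma> j) = cartan_A i j"
    proof (intro ballI)
      fix i j assume ij: "i \<in> ?P1 \<union> ?P2" "j \<in> ?P1 \<union> ?P2"
      \<comment> \<open>Nodes from different intervals are never adjacent, and
        \<open>\<sigma>\<close> preserves both intervals.\<close>
      have far: "cartan_A a b = 0" "cartan_A b a = 0" if "a \<in> ?P1" "b \<in> ?P2" for a b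
      proof -
        have "a + 2 \<le> b" using that n(2) by simp
        then show "cartan_A a b = 0" "cartan_A b a = 0" by (simp_all add: cartan_A_def)
      qed
      have near: "cartan_A (\<sigma> i) (\<sigma> j) = cartan_A i j" if "\<sigma> i - \<sigma> j = j - i"
        using that by (auto simp: cartan_A_def)
      have P2: "\<not> a \<le> 2 * m - 1" if "a \<in> ?P2" for a using that n(2) m(1) by simp
      show "cartan_A (\<sigma> i) (\<sigma> j) = cartan_A i j"
        using ij
      proof (elim UnE)
        assume "i \<in> ?P1" "j \<in> ?P1"
        then show ?thesis by (intro near) (simp add: \<sigma>_def)
      next
        assume "i \<in> ?P2" "j \<in> ?P2"
        then show ?thesis using P2 by (intro near) (simp add: \<sigma>_def)
      qed (use far \<sigma>1 \<sigma>2 in metis)+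
    qed
    show "\<forall>i\<in>?Q. \<forall>j\<in>?Q. cartan_A (n + 1 - i) (n + 1 - j) = cartan_A i j"
      by (auto simp: cartan_A_def)
    \<comment> \<open>In this form the image is visibly invariant under the flip.\<close>
    have \<sigma>J: "\<sigma> ` ?J = (\<lambda>j. 2 * m - j) ` J \<union> (\<lambda>j. n + 1 - (2 * m - j)) ` J"
    proof -
      have "\<forall>j\<in>J. \<sigma> j = 2 * m - j \<and> \<sigma> (n + 1 - j) = n + 1 - (2 * m - j)"
        using m n by (fastforce simp: \<sigma>_def)
      then show ?thesis unfolding image_Un image_image by simp
    qed
    show "?J \<subseteq> ?P1 \<union> ?P2" using m n by auto
    show "\<sigma> ` ?J \<subseteq> ?P1 \<union> ?P2" unfolding \<sigma>J using m n by auto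
    show "\<sigma> ` ?J \<subseteq> ?Q" unfolding \<sigma>J using m n by auto
    show "(\<lambda>i. n + 1 - i) ` \<sigma> ` ?J = \<sigma> ` ?J"
      unfolding \<sigma>J by (simp add: image_Un image_image Un_commute)
    show "\<sigma> ` \<sigma> ` ?J = ?J"
    proof -
      have "\<forall>j\<in>?J. \<sigma> (\<sigma> j) = j" using m n by (fastforce simp: \<sigma>_def)
      then show ?thesis unfolding image_image by simp
    qed
    show "orthogonal (type_A n) ?J ?Q" using m n by (fastforce simp: orthogonal_def type_A_def)
    show "K \<subseteq> ?Q" "(\<lambda>i. n + 1 - i) ` K \<subseteq> ?Q" using K(1) m n by auto
    show "(\<lambda>i. n + 1 - i) ` (\<lambda>i. n + 1 - i) ` K = K" by (simp add: image_image)
    show "orthogonal (type_A n) K (?P1 \<union> ?P2)" "orthogonal (type_A n) ((\<lambda>i. n + 1 - i) ` K) (?P1 \<union> ?P2)"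
      using K(1) by (fastforce simp: orthogonal_def type_A_def)+
    show "weakly_orthogonal (type_A n) K ((\<lambda>i. n + 1 - i) ` K)" by (rule K(2))
  qed
qed

theorem theorem5p58:
  fixes m :: int and J :: "int set"
  assumes "0 \<le> m" and "J \<subseteq> {1..m - 1}"
  shows
    "(\<forall>n K. 1 \<le> n \<and> 4 * m - 1 \<le> n \<and> K \<subseteq> {2 * m + 1..n - 2 * m} \<and>
        weakly_orthogonal (type_A n) K ((\<lambda>k. n + 1 - k) ` K) \<longrightarrow>
        (\<exists>h \<in> monoid_hom (artin_monoid (type_B 2)) (artin_monoid (type_A n)).
           h (artin_gen (type_B 2) 1) =
             T_longest (type_A n) ({1..2 * m - 1} \<union> {n + 2 - 2 * m..n} \<union> K) \<and>
           h (artin_gen (type_B 2) 2) =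
             T_longest (type_A n) ({m + 1..n - m} \<union> J \<union> (\<lambda>j. n + 1 - j) ` J)))
     \<and>
     (\<forall>n K. 2 \<le> n \<and> 2 * m \<le> n \<and> K \<subseteq> {2 * m + 1..n} \<longrightarrow>
        (\<exists>h \<in> monoid_hom (artin_monoid (type_B 2)) (artin_monoid (type_B n)).
           h (artin_gen (type_B 2) 1) = T_longest (type_B n) ({1..2 * m - 1} \<union> K) \<and>
           h (artin_gen (type_B 2) 2) = T_longest (type_B n) ({m + 1..n} \<union> J)))
     \<and>
     (\<forall>n K. 3 \<le> n \<and> 2 * m \<le> n \<and> K \<subseteq> {2 * m + 1..n + 1} \<and>
        (n = 2 * m \<longrightarrow> n + 1 \<notin> K) \<and>
        (even (n - m) \<longrightarrow>
           weakly_orthogonal (type_D (n + 1)) K (transpose n (n + 1) ` K)) \<longrightarrow>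
        (\<exists>h \<in> monoid_hom (artin_monoid (type_B 2)) (artin_monoid (type_D (n + 1))).
           h (artin_gen (type_B 2) 1) =
             T_longest (type_D (n + 1)) ({1..2 * m - 1} \<union> K) \<and>
           h (artin_gen (type_B 2) 2) =
             T_longest (type_D (n + 1)) ({m + 1..n + 1} \<union> J)))"
  using assms by (intro conjI allI impI B2_hom_type_A B2_hom_type_B B2_hom_type_D) auto

end
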